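(* Let $\mathcal{C}$ be a Krull--Schmidt cluster category, and let $\mathcal{T},\mathcal{U}$ be cluster-tilting subcategories of $\mathcal{C}$. Then $\operatorname{indec}\mathcal{T}$ and $\operatorname{indec}\mathcal{U}$ have the same cardinality; in particular, if one cluster-tilting subcategory of $\mathcal{C}$ is additively finite, then all are. If $\mathcal{C}$ has a weak cluster structure, then the sets $\operatorname{mut}\mathcal{T}$ and $\operatorname{mut}\mathcal{U}$ of (isomorphism classes of) mutable indecomposable objects of $\mathcal{T}$ and $\mathcal{U}$ have the same cardinality.
   Context: $\mathbb{K}$ is a perfect field; categories are additive and $\mathbb{K}$-linear; $\operatorname{indec}\mathcal{A}$ is a set of representatives of the isomorphism classes of indecomposable objects of $\mathcal{A}$, and $\mathcal{A}$ is additively finite if this set is finite. Cluster categories. Extriangulated categories are those of Nakaoka--Palu: they carry a bifunctor $\operatorname{Ext}^1$, and each element of $\operatorname{Ext}^1_{\mathcal{C}}(X,Y)$ is realised by a conflation $Y\to E\to X$ (an inflation followed by a deflation). Exact categories, and triangulated categories with $\operatorname{Ext}^1(X,Y)=\operatorname{Hom}(X,\Sigma Y)$, are examples. An object $P$ is projective if $\operatorname{Ext}^1(P,-)=0$ and injective if $\operatorname{Ext}^1(-,P)=0$; $\mathcal{C}$ is Frobenius if it has enough projectives and enough injectives and these coincide. For a full additively closed subcategory $\mathcal{P}$ of projective-injectives, the additive quotient $\mathcal{C}/\mathcal{P}$ is extriangulated with $\operatorname{Ext}^1_{\mathcal{C}/\mathcal{P}}=\operatorname{Ext}^1_{\mathcal{C}}$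 and conflations the images of those of $\mathcal{C}$; $\mathcal{C}$ is algebraic if it is equivalent, as an extriangulated category, to such a quotient $\mathcal{E}/\mathcal{P}$ of an exact category $\mathcal{E}$. If $\mathcal{C}$ is Frobenius, $\underline{\mathcal{C}}$ denotes its quotient by all projectives, which is triangulated with suspension $\Sigma$. A right $\mathcal{T}$-approximation of $X$ is a map $T_0\to X$ with $T_0\in\mathcal{T}$ through which every map from an object of $\mathcal{T}$ to $X$ factors; left approximations are dual. A full subcategory $\mathcal{T}\subseteq\mathcal{C}$ is cluster-tilting if $\mathcal{T}=\{X:\operatorname{Ext}^1(T,X)=0\ \forall T\in\mathcal{T}\}=\{X:\operatorname{Ext}^1(X,T)=0\ \forall T\in\mathcal{T}\}$ and every object of $\mathcal{C}$ has a left $\mathcal{T}$-approximation which is an inflation and a right $\mathcal{T}$-approximation which is a deflation. A cluster category is an idempotent complete algebraic Frobenius extriangulated category $\mathcal{C}$ having a cluster-tilting subcategory and such that $\underline{\mathcal{C}}$ is Hom-finite and $2$-Calabi--Yau (functorially $\operatorname{Hom}(X,Y)\cong\operatorname{Hom}_{\mathbb{K}}(\operatorname{Hom}(Y,\Sigma^2X),\mathbb{K})$). Mutation. For $T\in\operatorname{indec}\mathcal{T}$, $\mathcal{T}\setminus T$ is the additively closed subcategory with indecomposables $\operatorname{indec}\mathcal{T}\setminus\{T\}$. $T$ is mutable in $\mathcal{T}$ if there is an indecomposable $T^*\not\cong T$ such that $\operatorname{add}(\mathcal{T}\setminus T\cup\{T^*\})$ is cluster-tilting and there are non-split conflations $T^*\to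 T^+\to T$ and $T\to T^-\to T^*$ in which $T^+\to T$ and $T\to T^-$ are right and left $(\mathcal{T}\setminus T)$-approximations. A Krull--Schmidt cluster category has a weak cluster structure if in every cluster-tilting subcategory all non-projective indecomposables are mutable. *)

theory Defs
  imports "HOL-Computational_Algebra.Primes" "HOL-Library.Equipollence" "HOL-Algebra.Module"
begin

section \<open>Fields and vector spaces\<close>

text \<open>Surjectivity of Frobenius in positive characteristic; no condition in characteristic 0.\<close>

definition perfect_field :: "('k, 'r) ring_scheme \<Rightarrow> bool" where
  "perfect_field K \<longleftrightarrow> field K \<and>
    (\<forall>p::nat. prime p \<and> [p] \<cdot>\<^bsub>K\<^esub> \<one>\<^bsub>K\<^esub> = \<zero>\<^bsub>K\<^esub> \<longrightarrow>
       (\<forall>a \<in> carrier K. \<exists>b \<in> carrier K. b [^]\<^bsub>K\<^esub> p = a))"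

definition linear_map :: "('k, 'r) ring_scheme \<Rightarrow> ('k, 'a) module \<Rightarrow> ('k, 'b) module \<Rightarrow> ('a \<Rightarrow> 'b) \<Rightarrow> bool" where
  "linear_map K V W f \<longleftrightarrow> f \<in> carrier V \<rightarrow> carrier W \<and>
    (\<forall>u \<in> carrier V. \<forall>v \<in> carrier V. f (u \<oplus>\<^bsub>V\<^esub> v) = f u \<oplus>\<^bsub>W\<^esub> f v) \<and>
    (\<forall>k \<in> carrier K. \<forall>v \<in> carrier V. f (k \<odot>\<^bsub>V\<^esub> v) = k \<odot>\<^bsub>W\<^esub> f v)"

definition linear_iso :: "('k, 'r) ring_scheme \<Rightarrow> ('k, 'a) module \<Rightarrow> ('k, 'b) module \<Rightarrow> ('a \<Rightarrow> 'b) \<Rightarrow> bool" where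
  "linear_iso K V W f \<longleftrightarrow> linear_map K V W f \<and> bij_betw f (carrier V) (carrier W)"

definition finite_dimensional :: "('k, 'r) ring_scheme \<Rightarrow> ('k, 'a) module \<Rightarrow> bool" where
  "finite_dimensional K V \<longleftrightarrow> (\<exists>B. finite B \<and> B \<subseteq> carrier V \<and>
    (\<forall>v \<in> carrier V. \<exists>c \<in> B \<rightarrow> carrier K. v = (\<Oplus>\<^bsub>V\<^esub>b\<in>B. c b \<odot>\<^bsub>V\<^esub> b)))"

text \<open>The multiplicative part of a module record plays no role and is left undefined here and below.\<close>

definition self_module :: "('k, 'r) ring_scheme \<Rightarrow> ('k, 'k) module" where
  "self_module K = \<lparr>carrier = carrier K, mult = undefined, one = undefined,
     zero = \<zero>\<^bsub>K\<^esub>, add = (\<oplus>\<^bsub>K\<^esub>), smult = (\<otimes>\<^bsub>K\<^esub>)\<rparr>"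

definition dual_space :: "('k, 'r) ring_scheme \<Rightarrow> ('k, 'a) module \<Rightarrow> ('k, 'a \<Rightarrow> 'k) module" where
  "dual_space K V = \<lparr>
     carrier = {\<phi> \<in> extensional (carrier V). linear_map K V (self_module K) \<phi>},
     mult = undefined, one = undefined,
     zero = (\<lambda>v \<in> carrier V. \<zero>\<^bsub>K\<^esub>),
     add = (\<lambda>\<phi> \<psi>. \<lambda>v \<in> carrier V. \<phi> v \<oplus>\<^bsub>K\<^esub> \<psi> v),
     smult = (\<lambda>k \<phi>. \<lambda>v \<in> carrier V. k \<otimes>\<^bsub>K\<^esub> \<phi> v)\<rparr>"


section \<open>Linear and additive categories\<close>

text \<open>Morphism spaces for different pairs of objects are disjoint (see below), so that a
  morphism determines its source and target and composition needs no object arguments.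
  \<open>cmp C g f\<close>, written \<open>g \<cdot>\<^bsub>C\<^esub> f\<close>, is \<open>g\<close> after \<open>f\<close>.\<close>

record ('k, 'o, 'm) lincat =
  Ob :: "'o set"
  Hom :: "'o \<Rightarrow> 'o \<Rightarrow> ('k, 'm) module"
  ident :: "'o \<Rightarrow> 'm"
  cmp :: "'m \<Rightarrow> 'm \<Rightarrow> 'm" (infixl \<open>\<cdot>\<index>\<close> 70)

abbreviation mor :: "('k, 'o, 'm, 'z) lincat_scheme \<Rightarrow> 'o \<Rightarrow> 'o \<Rightarrow> 'm set" where
  "mor C X Y \<equiv> carrier (Hom C X Y)"

abbreviation zero_mor :: "('k, 'o, 'm, 'z) lincat_scheme \<Rightarrow> 'o \<Rightarrow> 'o \<Rightarrow> 'm" where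
  "zero_mor C X Y \<equiv> \<zero>\<^bsub>Hom C X Y\<^esub>"

locale linear_category =
  fixes K :: "('k, 'r) ring_scheme" and C :: "('k, 'o, 'm, 'z) lincat_scheme"
  assumes K_field: "field K"
    and Hom_module: "\<lbrakk>X \<in> Ob C; Y \<in> Ob C\<rbrakk> \<Longrightarrow> module K (Hom C X Y)"
    and Hom_disjoint: "\<lbrakk>X \<in> Ob C; Y \<in> Ob C; X' \<in> Ob C; Y' \<in> Ob C; f \<in> mor C X Y; f \<in> mor C X' Y'\<rbrakk>
      \<Longrightarrow> X = X' \<and> Y = Y'"
    and ident_closed: "X \<in> Ob C \<Longrightarrow> ident C X \<in> mor C X X"
    and cmp_closed: "\<lbrakk>X \<in> Ob C; Y \<in> Ob C; Z \<in> Ob C; f \<in> mor C X Y; g \<in> mor C Y Z\<rbrakk>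
      \<Longrightarrow> g \<cdot>\<^bsub>C\<^esub> f \<in> mor C X Z"
    and cmp_assoc: "\<lbrakk>W \<in> Ob C; X \<in> Ob C; Y \<in> Ob C; Z \<in> Ob C;
        f \<in> mor C W X; g \<in> mor C X Y; h \<in> mor C Y Z\<rbrakk>
      \<Longrightarrow> (h \<cdot>\<^bsub>C\<^esub> g) \<cdot>\<^bsub>C\<^esub> f = h \<cdot>\<^bsub>C\<^esub> (g \<cdot>\<^bsub>C\<^esub> f)"
    and cmp_ident_left: "\<lbrakk>X \<in> Ob C; Y \<in> Ob C; f \<in> mor C X Y\<rbrakk> \<Longrightarrow> ident C Y \<cdot>\<^bsub>C\<^esub> f = f"
    and cmp_ident_right: "\<lbrakk>X \<in> Ob C; Y \<in> Ob C; f \<in> mor C X Y\<rbrakk> \<Longrightarrow> f \<cdot>\<^bsub>C\<^esub> ident C X = f"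
    and cmp_linear_left: "\<lbrakk>X \<in> Ob C; Y \<in> Ob C; Z \<in> Ob C; f \<in> mor C X Y\<rbrakk>
      \<Longrightarrow> linear_map K (Hom C Y Z) (Hom C X Z) (\<lambda>g. g \<cdot>\<^bsub>C\<^esub> f)"
    and cmp_linear_right: "\<lbrakk>X \<in> Ob C; Y \<in> Ob C; Z \<in> Ob C; g \<in> mor C Y Z\<rbrakk>
      \<Longrightarrow> linear_map K (Hom C X Y) (Hom C X Z) (\<lambda>f. g \<cdot>\<^bsub>C\<^esub> f)"

definition is_iso :: "('k, 'o, 'm, 'z) lincat_scheme \<Rightarrow> 'o \<Rightarrow> 'o \<Rightarrow> 'm \<Rightarrow> bool" where
  "is_iso C X Y f \<longleftrightarrow> X \<in> Ob C \<and> Y \<in> Ob C \<and> f \<in> mor C X Y \<and>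
    (\<exists>g \<in> mor C Y X. g \<cdot>\<^bsub>C\<^esub> f = ident C X \<and> f \<cdot>\<^bsub>C\<^esub> g = ident C Y)"

definition isomorphic :: "('k, 'o, 'm, 'z) lincat_scheme \<Rightarrow> 'o \<Rightarrow> 'o \<Rightarrow> bool" where
  "isomorphic C X Y \<longleftrightarrow> (\<exists>f. is_iso C X Y f)"

definition zero_object :: "('k, 'o, 'm, 'z) lincat_scheme \<Rightarrow> 'o \<Rightarrow> bool" where
  "zero_object C Z \<longleftrightarrow> Z \<in> Ob C \<and> ident C Z = zero_mor C Z Z"

definition is_biproduct ::
  "('k, 'o, 'm, 'z) lincat_scheme \<Rightarrow> 'o \<Rightarrow> 'o \<Rightarrow> 'o \<Rightarrow> 'm \<Rightarrow> 'm \<Rightarrow> 'm \<Rightarrow> 'm \<Rightarrow> bool" where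
  "is_biproduct C S X Y i j p q \<longleftrightarrow> S \<in> Ob C \<and> X \<in> Ob C \<and> Y \<in> Ob C \<and>
    i \<in> mor C X S \<and> j \<in> mor C Y S \<and> p \<in> mor C S X \<and> q \<in> mor C S Y \<and>
    p \<cdot>\<^bsub>C\<^esub> i = ident C X \<and> q \<cdot>\<^bsub>C\<^esub> j = ident C Y \<and>
    q \<cdot>\<^bsub>C\<^esub> i = zero_mor C X Y \<and> p \<cdot>\<^bsub>C\<^esub> j = zero_mor C Y X \<and>
    i \<cdot>\<^bsub>C\<^esub> p \<oplus>\<^bsub>Hom C S S\<^esub> j \<cdot>\<^bsub>C\<^esub> q = ident C S"

text \<open>\<open>direct_sum C S X Y\<close> means that \<open>S\<close> is isomorphic to \<open>X \<oplus> Y\<close>.\<close>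

definition direct_sum :: "('k, 'o, 'm, 'z) lincat_scheme \<Rightarrow> 'o \<Rightarrow> 'o \<Rightarrow> 'o \<Rightarrow> bool" where
  "direct_sum C S X Y \<longleftrightarrow> (\<exists>i j p q. is_biproduct C S X Y i j p q)"

fun direct_sum_list :: "('k, 'o, 'm, 'z) lincat_scheme \<Rightarrow> 'o \<Rightarrow> 'o list \<Rightarrow> bool" where
  "direct_sum_list C S [] \<longleftrightarrow> zero_object C S"
| "direct_sum_list C S (X # Xs) \<longleftrightarrow> (\<exists>S'. direct_sum C S X S' \<and> direct_sum_list C S' Xs)"

locale additive_category = linear_category K C
  for K :: "('k, 'r) ring_scheme" and C :: "('k, 'o, 'm, 'z) lincat_scheme" +
  assumes zero_object_exists: "\<exists>Z. zero_object C Z"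
    and biproduct_exists: "\<lbrakk>X \<in> Ob C; Y \<in> Ob C\<rbrakk> \<Longrightarrow> \<exists>S. direct_sum C S X Y"

definition idempotent_complete :: "('k, 'o, 'm, 'z) lincat_scheme \<Rightarrow> bool" where
  "idempotent_complete C \<longleftrightarrow> (\<forall>X \<in> Ob C. \<forall>e \<in> mor C X X. e \<cdot>\<^bsub>C\<^esub> e = e \<longrightarrow>
    (\<exists>Y \<in> Ob C. \<exists>r \<in> mor C X Y. \<exists>s \<in> mor C Y X. s \<cdot>\<^bsub>C\<^esub> r = e \<and> r \<cdot>\<^bsub>C\<^esub> s = ident C Y))"

text \<open>Full subcategories are given by their sets of objects.  Additively closed means closed
  under finite direct sums and direct summands (hence under isomorphism).\<close>

definition additively_closed :: "('k, 'o, 'm, 'z) lincat_scheme \<Rightarrow> 'o set \<Rightarrow> bool" where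
  "additively_closed C P \<longleftrightarrow> P \<subseteq> Ob C \<and> (\<forall>Z. zero_object C Z \<longrightarrow> Z \<in> P) \<and>
    (\<forall>S X Y. direct_sum C S X Y \<longrightarrow> (S \<in> P \<longleftrightarrow> X \<in> P \<and> Y \<in> P))"

definition add_closure :: "('k, 'o, 'm, 'z) lincat_scheme \<Rightarrow> 'o set \<Rightarrow> 'o set" where
  "add_closure C A = {X. \<exists>S Y Xs. set Xs \<subseteq> A \<and> direct_sum_list C S Xs \<and> direct_sum C S X Y}"

definition indecomposable :: "('k, 'o, 'm, 'z) lincat_scheme \<Rightarrow> 'o \<Rightarrow> bool" where
  "indecomposable C X \<longleftrightarrow> X \<in> Ob C \<and> \<not> zero_object C X \<and>
    (\<forall>Y Z. direct_sum C X Y Z \<longrightarrow> zero_object C Y \<or> zero_object C Z)"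

text \<open>The endomorphism ring is local: it is nonzero and its non-units are closed under addition.\<close>

definition local_endomorphism_ring :: "('k, 'o, 'm, 'z) lincat_scheme \<Rightarrow> 'o \<Rightarrow> bool" where
  "local_endomorphism_ring C X \<longleftrightarrow> X \<in> Ob C \<and> \<not> zero_object C X \<and>
    (\<forall>f \<in> mor C X X. \<forall>g \<in> mor C X X.
       \<not> is_iso C X X f \<and> \<not> is_iso C X X g \<longrightarrow> \<not> is_iso C X X (f \<oplus>\<^bsub>Hom C X X\<^esub> g))"

definition krull_schmidt :: "('k, 'o, 'm, 'z) lincat_scheme \<Rightarrow> bool" where
  "krull_schmidt C \<longleftrightarrow> (\<forall>X \<in> Ob C. \<exists>Xs.
    direct_sum_list C X Xs \<and> (\<forall>Y \<in> set Xs. local_endomorphism_ring C Y))"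

text \<open>The chosen representative depends only on the isomorphism class.\<close>

definition iso_rep :: "('k, 'o, 'm, 'z) lincat_scheme \<Rightarrow> 'o \<Rightarrow> 'o" where
  "iso_rep C X = (SOME Y. isomorphic C X Y)"

definition indec :: "('k, 'o, 'm, 'z) lincat_scheme \<Rightarrow> 'o set \<Rightarrow> 'o set" where
  "indec C A = iso_rep C ` {X \<in> A. indecomposable C X}"

definition additively_finite :: "('k, 'o, 'm, 'z) lincat_scheme \<Rightarrow> 'o set \<Rightarrow> bool" where
  "additively_finite C A \<longleftrightarrow> finite (indec C A)"

definition right_approximation :: "('k, 'o, 'm, 'z) lincat_scheme \<Rightarrow> 'o set \<Rightarrow> 'o \<Rightarrow> 'o \<Rightarrow> 'm \<Rightarrow> bool" where
  "right_approximation C T T0 X f \<longleftrightarrow> T0 \<in> T \<and> f \<in> mor C T0 X \<and>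
    (\<forall>T' \<in> T. \<forall>g \<in> mor C T' X. \<exists>h \<in> mor C T' T0. f \<cdot>\<^bsub>C\<^esub> h = g)"

definition left_approximation :: "('k, 'o, 'm, 'z) lincat_scheme \<Rightarrow> 'o set \<Rightarrow> 'o \<Rightarrow> 'o \<Rightarrow> 'm \<Rightarrow> bool" where
  "left_approximation C T X T0 f \<longleftrightarrow> T0 \<in> T \<and> f \<in> mor C X T0 \<and>
    (\<forall>T' \<in> T. \<forall>g \<in> mor C X T'. \<exists>h \<in> mor C T0 T'. h \<cdot>\<^bsub>C\<^esub> f = g)"


section \<open>Extriangulated categories\<close>

text \<open>\<open>Ext C D A\<close> is the space of extensions realised by sequences \<open>A \<rightarrow> B \<rightarrow> D\<close>.
  For \<open>c : D' \<rightarrow> D\<close> and \<open>a : A \<rightarrow> A'\<close>, \<open>ExtMap C c a\<close> is the induced map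
  \<open>Ext C D A \<rightarrow> Ext C D' A'\<close>.  \<open>Rlz C D A \<delta>\<close> is the equivalence class of
  sequences realising \<open>\<delta>\<close>, as a set of pairs (inflation, deflation).\<close>

record ('k, 'o, 'm, 'e) extri = "('k, 'o, 'm) lincat" +
  Ext :: "'o \<Rightarrow> 'o \<Rightarrow> ('k, 'e) module"
  ExtMap :: "'m \<Rightarrow> 'm \<Rightarrow> 'e \<Rightarrow> 'e"
  Rlz :: "'o \<Rightarrow> 'o \<Rightarrow> 'e \<Rightarrow> ('m \<times> 'm) set"

abbreviation pushforward :: "('k, 'o, 'm, 'e) extri \<Rightarrow> 'o \<Rightarrow> 'm \<Rightarrow> 'e \<Rightarrow> 'e" where
  "pushforward C D a \<delta> \<equiv> ExtMap C (ident C D) a \<delta>"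

abbreviation pullback :: "('k, 'o, 'm, 'e) extri \<Rightarrow> 'm \<Rightarrow> 'o \<Rightarrow> 'e \<Rightarrow> 'e" where
  "pullback C c A \<delta> \<equiv> ExtMap C c (ident C A) \<delta>"

definition is_sequence :: "('k, 'o, 'm, 'z) lincat_scheme \<Rightarrow> 'o \<Rightarrow> 'o \<Rightarrow> 'o \<Rightarrow> 'm \<Rightarrow> 'm \<Rightarrow> bool" where
  "is_sequence C A B D x y \<longleftrightarrow>
     A \<in> Ob C \<and> B \<in> Ob C \<and> D \<in> Ob C \<and> x \<in> mor C A B \<and> y \<in> mor C B D"

definition equivalent_sequences ::
  "('k, 'o, 'm, 'z) lincat_scheme \<Rightarrow> 'o \<Rightarrow> 'o \<Rightarrow> 'm \<times> 'm \<Rightarrow> 'm \<times> 'm \<Rightarrow> bool" where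
  "equivalent_sequences C A D s s' \<longleftrightarrow> (\<exists>B B' b.
     is_sequence C A B D (fst s) (snd s) \<and> is_sequence C A B' D (fst s') (snd s') \<and>
     is_iso C B B' b \<and> b \<cdot>\<^bsub>C\<^esub> fst s = fst s' \<and> snd s' \<cdot>\<^bsub>C\<^esub> b = snd s)"

definition realises ::
  "('k, 'o, 'm, 'e) extri \<Rightarrow> 'o \<Rightarrow> 'o \<Rightarrow> 'o \<Rightarrow> 'm \<Rightarrow> 'm \<Rightarrow> 'e \<Rightarrow> bool" where
  "realises C A B D x y \<delta> \<longleftrightarrow>
     is_sequence C A B D x y \<and> \<delta> \<in> carrier (Ext C D A) \<and> (x, y) \<in> Rlz C D A \<delta>"

definition conflation :: "('k, 'o, 'm, 'e) extri \<Rightarrow> 'o \<Rightarrow> 'o \<Rightarrow> 'o \<Rightarrow> 'm \<Rightarrow> 'm \<Rightarrow> bool" where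
  "conflation C A B D x y \<longleftrightarrow> (\<exists>\<delta>. realises C A B D x y \<delta>)"

definition inflation :: "('k, 'o, 'm, 'e) extri \<Rightarrow> 'm \<Rightarrow> bool" where
  "inflation C x \<longleftrightarrow> (\<exists>A B D y. conflation C A B D x y)"

definition deflation :: "('k, 'o, 'm, 'e) extri \<Rightarrow> 'm \<Rightarrow> bool" where
  "deflation C y \<longleftrightarrow> (\<exists>A B D x. conflation C A B D x y)"

text \<open>The axioms of Nakaoka and Palu: a bilinear bifunctor (ET1) with an additive realisation
  (ET2), subject to (ET3), (ET4) and their duals.\<close>

locale extriangulated_category = additive_category K C
  for K :: "('k, 'r) ring_scheme" and C :: "('k, 'o, 'm, 'e) extri" +
  assumes Ext_module: "\<lbrakk>D \<in> Ob C; A \<in> Ob C\<rbrakk> \<Longrightarrow> module K (Ext C D A)"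
    and ExtMap_linear: "\<lbrakk>D \<in> Ob C; D' \<in> Ob C; A \<in> Ob C; A' \<in> Ob C; c \<in> mor C D' D; a \<in> mor C A A'\<rbrakk>
      \<Longrightarrow> linear_map K (Ext C D A) (Ext C D' A') (ExtMap C c a)"
    and ExtMap_linear_left: "\<lbrakk>D \<in> Ob C; D' \<in> Ob C; A \<in> Ob C; A' \<in> Ob C; a \<in> mor C A A';
        \<delta> \<in> carrier (Ext C D A)\<rbrakk>
      \<Longrightarrow> linear_map K (Hom C D' D) (Ext C D' A') (\<lambda>c. ExtMap C c a \<delta>)"
    and ExtMap_linear_right: "\<lbrakk>D \<in> Ob C; D' \<in> Ob C; A \<in> Ob C; A' \<in> Ob C; c \<in> mor C D' D;
        \<delta> \<in> carrier (Ext C D A)\<rbrakk>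
      \<Longrightarrow> linear_map K (Hom C A A') (Ext C D' A') (\<lambda>a. ExtMap C c a \<delta>)"
    and ExtMap_ident: "\<lbrakk>D \<in> Ob C; A \<in> Ob C; \<delta> \<in> carrier (Ext C D A)\<rbrakk>
      \<Longrightarrow> ExtMap C (ident C D) (ident C A) \<delta> = \<delta>"
    and ExtMap_cmp: "\<lbrakk>D \<in> Ob C; D' \<in> Ob C; D'' \<in> Ob C; A \<in> Ob C; A' \<in> Ob C; A'' \<in> Ob C;
        c \<in> mor C D' D; c' \<in> mor C D'' D'; a \<in> mor C A A'; a' \<in> mor C A' A'';
        \<delta> \<in> carrier (Ext C D A)\<rbrakk>
      \<Longrightarrow> ExtMap C (c \<cdot>\<^bsub>C\<^esub> c') (a' \<cdot>\<^bsub>C\<^esub> a) \<delta> = ExtMap C c' a' (ExtMap C c a \<delta>)"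
    and Rlz_class: "\<lbrakk>D \<in> Ob C; A \<in> Ob C; \<delta> \<in> carrier (Ext C D A)\<rbrakk>
      \<Longrightarrow> \<exists>B x y. is_sequence C A B D x y \<and>
            Rlz C D A \<delta> = {s. equivalent_sequences C A D (x, y) s}"
    and Rlz_morphism: "\<lbrakk>realises C A B D x y \<delta>; realises C A' B' D' x' y' \<delta>';
        a \<in> mor C A A'; c \<in> mor C D D'; pushforward C D a \<delta> = pullback C c A' \<delta>'\<rbrakk>
      \<Longrightarrow> \<exists>b \<in> mor C B B'. b \<cdot>\<^bsub>C\<^esub> x = x' \<cdot>\<^bsub>C\<^esub> a \<and> y' \<cdot>\<^bsub>C\<^esub> b = c \<cdot>\<^bsub>C\<^esub> y"
    and Rlz_zero: "is_biproduct C S A D i j p q \<Longrightarrow> (i, q) \<in> Rlz C D A \<zero>\<^bsub>Ext C D A\<^esub>"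
    and Rlz_sum: "\<lbrakk>realises C A B D x y \<delta>; realises C A' B' D' x' y' \<delta>';
        is_biproduct C SA A A' iA jA pA qA; is_biproduct C SB B B' iB jB pB qB;
        is_biproduct C SD D D' iD jD pD qD\<rbrakk>
      \<Longrightarrow> realises C SA SB SD
            (iB \<cdot>\<^bsub>C\<^esub> x \<cdot>\<^bsub>C\<^esub> pA \<oplus>\<^bsub>Hom C SA SB\<^esub> jB \<cdot>\<^bsub>C\<^esub> x' \<cdot>\<^bsub>C\<^esub> qA)
            (iD \<cdot>\<^bsub>C\<^esub> y \<cdot>\<^bsub>C\<^esub> pB \<oplus>\<^bsub>Hom C SB SD\<^esub> jD \<cdot>\<^bsub>C\<^esub> y' \<cdot>\<^bsub>C\<^esub> qB)
            (ExtMap C pD iA \<delta> \<oplus>\<^bsub>Ext C SD SA\<^esub> ExtMap C qD jA \<delta>')"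
    and ET3: "\<lbrakk>realises C A B D x y \<delta>; realises C A' B' D' x' y' \<delta>';
        a \<in> mor C A A'; b \<in> mor C B B'; b \<cdot>\<^bsub>C\<^esub> x = x' \<cdot>\<^bsub>C\<^esub> a\<rbrakk>
      \<Longrightarrow> \<exists>c \<in> mor C D D'. pushforward C D a \<delta> = pullback C c A' \<delta>' \<and> c \<cdot>\<^bsub>C\<^esub> y = y' \<cdot>\<^bsub>C\<^esub> b"
    and ET3_op: "\<lbrakk>realises C A B D x y \<delta>; realises C A' B' D' x' y' \<delta>';
        b \<in> mor C B B'; c \<in> mor C D D'; c \<cdot>\<^bsub>C\<^esub> y = y' \<cdot>\<^bsub>C\<^esub> b\<rbrakk>
      \<Longrightarrow> \<exists>a \<in> mor C A A'. pushforward C D a \<delta> = pullback C c A' \<delta>' \<and> b \<cdot>\<^bsub>C\<^esub> x = x' \<cdot>\<^bsub>C\<^esub> a"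
    and ET4: "\<lbrakk>realises C A B D f f' \<delta>; realises C B G F g g' \<delta>'\<rbrakk>
      \<Longrightarrow> \<exists>E h' d e \<delta>''. realises C A G E (g \<cdot>\<^bsub>C\<^esub> f) h' \<delta>'' \<and>
            realises C D E F d e (pushforward C F f' \<delta>') \<and>
            h' \<cdot>\<^bsub>C\<^esub> g = d \<cdot>\<^bsub>C\<^esub> f' \<and> e \<cdot>\<^bsub>C\<^esub> h' = g' \<and>
            pullback C d A \<delta>'' = \<delta> \<and>
            pushforward C E f \<delta>'' = pullback C e B \<delta>'"
    and ET4_op: "\<lbrakk>realises C D A B f' f \<delta>; realises C F B G g' g \<delta>'\<rbrakk>
      \<Longrightarrow> \<exists>E h' d e \<delta>''. realises C E A G h' (g \<cdot>\<^bsub>C\<^esub> f) \<delta>'' \<and>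
            realises C D E F d e (pullback C g' D \<delta>) \<and>
            h' \<cdot>\<^bsub>C\<^esub> d = f' \<and> f \<cdot>\<^bsub>C\<^esub> h' = g' \<cdot>\<^bsub>C\<^esub> e \<and>
            pushforward C G e \<delta>'' = \<delta>' \<and>
            pushforward C B d \<delta> = pullback C g E \<delta>''"

definition projective :: "('k, 'o, 'm, 'e) extri \<Rightarrow> 'o \<Rightarrow> bool" where
  "projective C P \<longleftrightarrow> P \<in> Ob C \<and> (\<forall>X \<in> Ob C. carrier (Ext C P X) = {\<zero>\<^bsub>Ext C P X\<^esub>})"

definition injective :: "('k, 'o, 'm, 'e) extri \<Rightarrow> 'o \<Rightarrow> bool" where
  "injective C P \<longleftrightarrow> P \<in> Ob C \<and> (\<forall>X \<in> Ob C. carrier (Ext C X P) = {\<zero>\<^bsub>Ext C X P\<^esub>})"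

definition frobenius :: "('k, 'o, 'm, 'e) extri \<Rightarrow> bool" where
  "frobenius C \<longleftrightarrow>
     (\<forall>X \<in> Ob C. \<exists>A P x y. projective C P \<and> conflation C A P X x y) \<and>
     (\<forall>X \<in> Ob C. \<exists>I D x y. injective C I \<and> conflation C X I D x y) \<and>
     (\<forall>P. projective C P \<longleftrightarrow> injective C P)"

definition split_conflation :: "('k, 'o, 'm, 'e) extri \<Rightarrow> 'o \<Rightarrow> 'o \<Rightarrow> 'o \<Rightarrow> 'm \<Rightarrow> 'm \<Rightarrow> bool" where
  "split_conflation C A B D x y \<longleftrightarrow> conflation C A B D x y \<and> (\<exists>s p. is_biproduct C B A D x s p y)"


section \<open>Quotients by projective-injectives\<close>

definition factor_ideal :: "('k, 'o, 'm, 'z) lincat_scheme \<Rightarrow> 'o set \<Rightarrow> 'o \<Rightarrow> 'o \<Rightarrow> 'm set" where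
  "factor_ideal C P X Y =
     {h \<cdot>\<^bsub>C\<^esub> g | g h Q. Q \<in> P \<and> g \<in> mor C X Q \<and> h \<in> mor C Q Y}"

text \<open>Morphisms of the quotient are cosets of the ideal of morphisms factoring through \<open>P\<close>.\<close>

definition qclass :: "('k, 'o, 'm, 'z) lincat_scheme \<Rightarrow> 'o set \<Rightarrow> 'm \<Rightarrow> 'm set" where
  "qclass C P f = {g. \<exists>X \<in> Ob C. \<exists>Y \<in> Ob C. f \<in> mor C X Y \<and> g \<in> mor C X Y \<and>
     g \<ominus>\<^bsub>Hom C X Y\<^esub> f \<in> factor_ideal C P X Y}"

definition quotient_Hom :: "('k, 'o, 'm, 'z) lincat_scheme \<Rightarrow> 'o set \<Rightarrow> 'o \<Rightarrow> 'o \<Rightarrow> ('k, 'm set) module" where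
  "quotient_Hom C P X Y = \<lparr>carrier = qclass C P ` mor C X Y, mult = undefined, one = undefined,
     zero = qclass C P (zero_mor C X Y),
     add = (\<lambda>F G. \<Union>f\<in>F. \<Union>g\<in>G. qclass C P (f \<oplus>\<^bsub>Hom C X Y\<^esub> g)),
     smult = (\<lambda>k F. \<Union>f\<in>F. qclass C P (k \<odot>\<^bsub>Hom C X Y\<^esub> f))\<rparr>"

definition quotient_lincat :: "('k, 'o, 'm, 'z) lincat_scheme \<Rightarrow> 'o set \<Rightarrow> ('k, 'o, 'm set) lincat" where
  "quotient_lincat C P = \<lparr>Ob = Ob C, Hom = quotient_Hom C P,
     ident = (\<lambda>X. qclass C P (ident C X)),
     cmp = (\<lambda>G F. \<Union>g\<in>G. \<Union>f\<in>F. qclass C P (g \<cdot>\<^bsub>C\<^esub> f))\<rparr>"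

text \<open>If \<open>P\<close> consists of projective-injectives, the action on extensions does not depend on
  the chosen representatives.  The image of the class realising \<open>\<delta>\<close> is closed up under
  equivalence of sequences in the quotient.\<close>

definition extri_quotient :: "('k, 'o, 'm, 'e) extri \<Rightarrow> 'o set \<Rightarrow> ('k, 'o, 'm set, 'e) extri" where
  "extri_quotient C P = lincat.extend (quotient_lincat C P) (extri.fields
     (Ext C)
     (\<lambda>G F \<delta>. ExtMap C (SOME c. c \<in> G) (SOME a. a \<in> F) \<delta>)
     (\<lambda>D A \<delta>. {s. \<exists>(x, y) \<in> Rlz C D A \<delta>.
        equivalent_sequences (quotient_lincat C P) A D (qclass C P x, qclass C P y) s}))"

definition stable_category :: "('k, 'o, 'm, 'e) extri \<Rightarrow> ('k, 'o, 'm set, 'e) extri" where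
  "stable_category C = extri_quotient C {P. projective C P}"


section \<open>Exact categories and algebraic extriangulated categories\<close>

definition is_kernel :: "('k, 'o, 'm, 'z) lincat_scheme \<Rightarrow> 'o \<Rightarrow> 'o \<Rightarrow> 'o \<Rightarrow> 'm \<Rightarrow> 'm \<Rightarrow> bool" where
  "is_kernel C A B D x y \<longleftrightarrow> is_sequence C A B D x y \<and> y \<cdot>\<^bsub>C\<^esub> x = zero_mor C A D \<and>
    (\<forall>W \<in> Ob C. \<forall>f \<in> mor C W B. y \<cdot>\<^bsub>C\<^esub> f = zero_mor C W D \<longrightarrow>
       (\<exists>!g. g \<in> mor C W A \<and> x \<cdot>\<^bsub>C\<^esub> g = f))"

definition is_cokernel :: "('k, 'o, 'm, 'z) lincat_scheme \<Rightarrow> 'o \<Rightarrow> 'o \<Rightarrow> 'o \<Rightarrow> 'm \<Rightarrow> 'm \<Rightarrow> bool" where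
  "is_cokernel C A B D x y \<longleftrightarrow> is_sequence C A B D x y \<and> y \<cdot>\<^bsub>C\<^esub> x = zero_mor C A D \<and>
    (\<forall>W \<in> Ob C. \<forall>f \<in> mor C B W. f \<cdot>\<^bsub>C\<^esub> x = zero_mor C A W \<longrightarrow>
       (\<exists>!g. g \<in> mor C D W \<and> g \<cdot>\<^bsub>C\<^esub> y = f))"

text \<open>Pushout of \<open>x : A \<rightarrow> B\<close> along \<open>a : A \<rightarrow> A'\<close>, with legs \<open>x' : A' \<rightarrow> B'\<close> and \<open>b : B \<rightarrow> B'\<close>;
  and pullback of \<open>y : B \<rightarrow> D\<close> along \<open>c : D' \<rightarrow> D\<close>, with legs \<open>y' : B' \<rightarrow> D'\<close> and \<open>b : B' \<rightarrow> B\<close>.\<close>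

definition is_pushout ::
  "('k, 'o, 'm, 'z) lincat_scheme \<Rightarrow> 'o \<Rightarrow> 'o \<Rightarrow> 'o \<Rightarrow> 'o \<Rightarrow> 'm \<Rightarrow> 'm \<Rightarrow> 'm \<Rightarrow> 'm \<Rightarrow> bool" where
  "is_pushout C A B A' B' x a x' b \<longleftrightarrow> B' \<in> Ob C \<and> x' \<in> mor C A' B' \<and> b \<in> mor C B B' \<and>
    b \<cdot>\<^bsub>C\<^esub> x = x' \<cdot>\<^bsub>C\<^esub> a \<and>
    (\<forall>W \<in> Ob C. \<forall>f \<in> mor C A' W. \<forall>g \<in> mor C B W. g \<cdot>\<^bsub>C\<^esub> x = f \<cdot>\<^bsub>C\<^esub> a \<longrightarrow>
       (\<exists>!h. h \<in> mor C B' W \<and> h \<cdot>\<^bsub>C\<^esub> x' = f \<and> h \<cdot>\<^bsub>C\<^esub> b = g))"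

definition is_pullback ::
  "('k, 'o, 'm, 'z) lincat_scheme \<Rightarrow> 'o \<Rightarrow> 'o \<Rightarrow> 'o \<Rightarrow> 'o \<Rightarrow> 'm \<Rightarrow> 'm \<Rightarrow> 'm \<Rightarrow> 'm \<Rightarrow> bool" where
  "is_pullback C B D B' D' y c y' b \<longleftrightarrow> B' \<in> Ob C \<and> y' \<in> mor C B' D' \<and> b \<in> mor C B' B \<and>
    y \<cdot>\<^bsub>C\<^esub> b = c \<cdot>\<^bsub>C\<^esub> y' \<and>
    (\<forall>W \<in> Ob C. \<forall>f \<in> mor C W D'. \<forall>g \<in> mor C W B. y \<cdot>\<^bsub>C\<^esub> g = c \<cdot>\<^bsub>C\<^esub> f \<longrightarrow>
       (\<exists>!h. h \<in> mor C W B' \<and> y' \<cdot>\<^bsub>C\<^esub> h = f \<and> b \<cdot>\<^bsub>C\<^esub> h = g))"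

text \<open>Quillen's axioms for a class \<open>S\<close> of kernel-cokernel pairs in an additive category.\<close>

definition exact_structure ::
  "('k, 'o, 'm, 'z) lincat_scheme \<Rightarrow> ('o \<Rightarrow> 'o \<Rightarrow> 'o \<Rightarrow> 'm \<Rightarrow> 'm \<Rightarrow> bool) \<Rightarrow> bool" where
  "exact_structure C S \<longleftrightarrow>
    (let infl = (\<lambda>A B x. \<exists>D y. S A B D x y); defl = (\<lambda>B D y. \<exists>A x. S A B D x y) in
     (\<forall>A B D x y. S A B D x y \<longrightarrow> is_kernel C A B D x y \<and> is_cokernel C A B D x y) \<and>
     (\<forall>A B D x y A' B' D' x' y' a b c. S A B D x y \<and> is_sequence C A' B' D' x' y' \<and>
        is_iso C A A' a \<and> is_iso C B B' b \<and> is_iso C D D' c \<and>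
        b \<cdot>\<^bsub>C\<^esub> x = x' \<cdot>\<^bsub>C\<^esub> a \<and> c \<cdot>\<^bsub>C\<^esub> y = y' \<cdot>\<^bsub>C\<^esub> b \<longrightarrow> S A' B' D' x' y') \<and>
     (\<forall>A \<in> Ob C. infl A A (ident C A)) \<and>
     (\<forall>A \<in> Ob C. defl A A (ident C A)) \<and>
     (\<forall>A B D x y. infl A B x \<and> infl B D y \<longrightarrow> infl A D (y \<cdot>\<^bsub>C\<^esub> x)) \<and>
     (\<forall>A B D x y. defl A B x \<and> defl B D y \<longrightarrow> defl A D (y \<cdot>\<^bsub>C\<^esub> x)) \<and>
     (\<forall>A B x. \<forall>A' \<in> Ob C. \<forall>a \<in> mor C A A'. infl A B x \<longrightarrow>
        (\<exists>B' x' b. is_pushout C A B A' B' x a x' b \<and> infl A' B' x')) \<and>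
     (\<forall>B D y. \<forall>D' \<in> Ob C. \<forall>c \<in> mor C D' D. defl B D y \<longrightarrow>
        (\<exists>B' y' b. is_pullback C B D B' D' y c y' b \<and> defl B' D' y')))"

text \<open>An exact category, viewed as an extriangulated category, is an extriangulated category
  whose conflations form an exact structure: extensions are then in natural bijection with
  Yoneda equivalence classes of conflations, since a realisation determines its extension
  when deflations are epic.\<close>

definition exact_category :: "('k, 'r) ring_scheme \<Rightarrow> ('k, 'o, 'm, 'e) extri \<Rightarrow> bool" where
  "exact_category K E \<longleftrightarrow> extriangulated_category K E \<and> exact_structure E (conflation E)"

text \<open>An equivalence of extriangulated categories consists of a linear equivalence
  \<open>(F0, F1)\<close> of categories and a natural isomorphism \<open>\<Gamma>\<close> between the extension bifunctors
  which is compatible with the realisations.\<close>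

definition extri_equivalence :: "('k, 'r) ring_scheme \<Rightarrow> ('k, 'o, 'm, 'e) extri \<Rightarrow> ('k, 'p, 'n, 'f) extri
    \<Rightarrow> ('o \<Rightarrow> 'p) \<Rightarrow> ('m \<Rightarrow> 'n) \<Rightarrow> ('o \<Rightarrow> 'o \<Rightarrow> 'e \<Rightarrow> 'f) \<Rightarrow> bool" where
  "extri_equivalence K C D F0 F1 \<Gamma> \<longleftrightarrow>
    F0 \<in> Ob C \<rightarrow> Ob D \<and>
    (\<forall>X \<in> Ob C. F1 (ident C X) = ident D (F0 X)) \<and>
    (\<forall>X \<in> Ob C. \<forall>Y \<in> Ob C. \<forall>Z \<in> Ob C. \<forall>f \<in> mor C X Y. \<forall>g \<in> mor C Y Z.
       F1 (g \<cdot>\<^bsub>C\<^esub> f) = F1 g \<cdot>\<^bsub>D\<^esub> F1 f) \<and>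
    (\<forall>X \<in> Ob C. \<forall>Y \<in> Ob C. linear_iso K (Hom C X Y) (Hom D (F0 X) (F0 Y)) F1) \<and>
    (\<forall>Y \<in> Ob D. \<exists>X \<in> Ob C. isomorphic D (F0 X) Y) \<and>
    (\<forall>X \<in> Ob C. \<forall>Y \<in> Ob C. linear_iso K (Ext C X Y) (Ext D (F0 X) (F0 Y)) (\<Gamma> X Y)) \<and>
    (\<forall>X \<in> Ob C. \<forall>X' \<in> Ob C. \<forall>Y \<in> Ob C. \<forall>Y' \<in> Ob C.
       \<forall>c \<in> mor C X' X. \<forall>a \<in> mor C Y Y'. \<forall>\<delta> \<in> carrier (Ext C X Y).
       \<Gamma> X' Y' (ExtMap C c a \<delta>) = ExtMap D (F1 c) (F1 a) (\<Gamma> X Y \<delta>)) \<and>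
    (\<forall>X \<in> Ob C. \<forall>Y \<in> Ob C. \<forall>\<delta> \<in> carrier (Ext C X Y). \<forall>(x, y) \<in> Rlz C X Y \<delta>.
       (F1 x, F1 y) \<in> Rlz D (F0 X) (F0 Y) (\<Gamma> X Y \<delta>))"

text \<open>HOL cannot quantify over types inside a formula, so the types in which the exact category
  \<open>E\<close> lives are passed as a parameter.  Where \<open>algebraic\<close> is a hypothesis of a theorem and these
  types are type variables, the theorem applies to exact categories over arbitrary types.\<close>

definition algebraic :: "('k, 'r) ring_scheme \<Rightarrow> ('k, 'p, 'n, 'f) extri itself
    \<Rightarrow> ('k, 'o, 'm, 'e) extri \<Rightarrow> bool" where
  "algebraic K (_ :: ('k, 'p, 'n, 'f) extri itself) C \<longleftrightarrow>
    (\<exists>(E :: ('k, 'p, 'n, 'f) extri) P F0 F1 \<Gamma>. exact_category K E \<and>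
       additively_closed E P \<and> (\<forall>Q \<in> P. projective E Q \<and> injective E Q) \<and>
       extri_equivalence K C (extri_quotient E P) F0 F1 \<Gamma>)"


section \<open>Suspension and the 2-Calabi--Yau property\<close>

text \<open>The suspension of \<open>X\<close> is the third term of a chosen conflation \<open>X \<rightarrow> I \<rightarrow> S X\<close> with \<open>I\<close>
  injective, realising \<open>d X\<close>.\<close>

definition is_suspension :: "('k, 'o, 'm, 'e) extri \<Rightarrow> ('o \<Rightarrow> 'o) \<Rightarrow> ('o \<Rightarrow> 'e) \<Rightarrow> bool" where
  "is_suspension C S d \<longleftrightarrow>
     (\<forall>X \<in> Ob C. \<exists>I x y. injective C I \<and> realises C X I (S X) x y (d X))"

text \<open>The suspension of a stable morphism \<open>F : X \<rightarrow> Y\<close> is the stable morphism consisting of all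
  \<open>c : S X \<rightarrow> S Y\<close> such that \<open>(f, c)\<close> is a morphism of extensions \<open>d X \<rightarrow> d Y\<close> for some \<open>f\<close> in \<open>F\<close>.
  Such \<open>c\<close> exist as \<open>f\<close> extends to the injectives, and any two of them differ by a morphism
  factoring through an injective.\<close>

definition suspension_map ::
  "('k, 'o, 'm, 'e) extri \<Rightarrow> ('o \<Rightarrow> 'o) \<Rightarrow> ('o \<Rightarrow> 'e) \<Rightarrow> 'o \<Rightarrow> 'o \<Rightarrow> 'm set \<Rightarrow> 'm set" where
  "suspension_map C S d X Y F = {c \<in> mor C (S X) (S Y).
     \<exists>f \<in> F. pushforward C (S X) f (d X) = pullback C c Y (d Y)}"

definition two_calabi_yau :: "('k, 'r) ring_scheme \<Rightarrow> ('k, 'o, 'm, 'e) extri \<Rightarrow> bool" where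
  "two_calabi_yau K C \<longleftrightarrow>
    (\<exists>S d \<Phi>. is_suspension C S d \<and>
       (\<forall>X \<in> Ob C. \<forall>Y \<in> Ob C.
          linear_iso K (Hom (stable_category C) X Y) (dual_space K (Hom (stable_category C) Y (S (S X)))) (\<Phi> X Y)) \<and>
       (\<forall>X \<in> Ob C. \<forall>X' \<in> Ob C. \<forall>Y \<in> Ob C. \<forall>Y' \<in> Ob C.
          \<forall>u \<in> mor (stable_category C) X' X. \<forall>v \<in> mor (stable_category C) Y Y'.
          \<forall>f \<in> mor (stable_category C) X Y. \<forall>h \<in> mor (stable_category C) Y' (S (S X')).
          \<Phi> X' Y' (v \<cdot>\<^bsub>stable_category C\<^esub> f \<cdot>\<^bsub>stable_category C\<^esub> u) h =
          \<Phi> X Y f (suspension_map C S d (S X') (S X) (suspension_map C S d X' X u)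
                     \<cdot>\<^bsub>stable_category C\<^esub> h \<cdot>\<^bsub>stable_category C\<^esub> v)))"

definition hom_finite :: "('k, 'r) ring_scheme \<Rightarrow> ('k, 'o, 'm, 'z) lincat_scheme \<Rightarrow> bool" where
  "hom_finite K C \<longleftrightarrow> (\<forall>X \<in> Ob C. \<forall>Y \<in> Ob C. finite_dimensional K (Hom C X Y))"


section \<open>Cluster categories and mutation\<close>

definition cluster_tilting :: "('k, 'o, 'm, 'e) extri \<Rightarrow> 'o set \<Rightarrow> bool" where
  "cluster_tilting C T \<longleftrightarrow>
     T = {X \<in> Ob C. \<forall>Y \<in> T. carrier (Ext C Y X) = {\<zero>\<^bsub>Ext C Y X\<^esub>}} \<and>
     T = {X \<in> Ob C. \<forall>Y \<in> T. carrier (Ext C X Y) = {\<zero>\<^bsub>Ext C X Y\<^esub>}} \<and>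
     (\<forall>X \<in> Ob C. \<exists>T0 f. left_approximation C T X T0 f \<and> inflation C f) \<and>
     (\<forall>X \<in> Ob C. \<exists>T0 f. right_approximation C T T0 X f \<and> deflation C f)"

definition cluster_category :: "('k, 'r) ring_scheme \<Rightarrow> ('k, 'p, 'n, 'f) extri itself
    \<Rightarrow> ('k, 'o, 'm, 'e) extri \<Rightarrow> bool" where
  "cluster_category K \<T> C \<longleftrightarrow> extriangulated_category K C \<and> idempotent_complete C \<and>
     algebraic K \<T> C \<and> frobenius C \<and> (\<exists>T. cluster_tilting C T) \<and>
     hom_finite K (stable_category C) \<and> two_calabi_yau K C"

text \<open>\<open>omit C T X\<close> is the additively closed subcategory with indecomposables those of \<open>T\<close>
  other than \<open>X\<close>.\<close>

definition omit :: "('k, 'o, 'm, 'z) lincat_scheme \<Rightarrow> 'o set \<Rightarrow> 'o \<Rightarrow> 'o set" where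
  "omit C T X = add_closure C (indec C T - {X})"

definition mutable :: "('k, 'o, 'm, 'e) extri \<Rightarrow> 'o set \<Rightarrow> 'o \<Rightarrow> bool" where
  "mutable C T X \<longleftrightarrow> X \<in> indec C T \<and>
     (\<exists>X'. indecomposable C X' \<and> \<not> isomorphic C X' X \<and>
        cluster_tilting C (add_closure C (omit C T X \<union> {X'})) \<and>
        (\<exists>B x y. conflation C X' B X x y \<and> \<not> split_conflation C X' B X x y \<and>
           right_approximation C (omit C T X) B X y) \<and>
        (\<exists>B x y. conflation C X B X' x y \<and> \<not> split_conflation C X B X' x y \<and>
           left_approximation C (omit C T X) X B x))"

definition mut :: "('k, 'o, 'm, 'e) extri \<Rightarrow> 'o set \<Rightarrow> 'o set" where
  "mut C T = {X \<in> indec C T. mutable C T X}"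

definition weak_cluster_structure :: "('k, 'o, 'm, 'e) extri \<Rightarrow> bool" where
  "weak_cluster_structure C \<longleftrightarrow> (\<forall>T. cluster_tilting C T \<longrightarrow>
     (\<forall>X \<in> indec C T. \<not> projective C X \<longrightarrow> mutable C T X))"

end

theory Submission
  imports Defs "HOL-Library.Poly_Mapping"
begin

text \<open>
  The proof compares split Grothendieck groups.  Write \<open>K0 X\<close> for the class of \<open>X\<close> in the free
  abelian group on isomorphism classes of indecomposables; it is well defined and additive by the
  Krull--Schmidt theorem, and the classes of the objects of \<open>T\<close> span the free abelian group on
  \<open>indec T\<close>.

  Every object \<open>X\<close> has a conflation \<open>T1 \<rightarrow> T0 \<rightarrow> X\<close> with \<open>T1\<close>, \<open>T0\<close> in \<open>T\<close>, because the kernel of a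
  right approximation lies in \<open>T\<close> (\<open>presentation_exists\<close>).  The index
  \<open>[T0] - [T1]\<close> is independent of the choice (\<open>presentation_unique\<close>), by the argument of
  Schanuel's lemma.  It is additive on direct sums, and \<open>index_conflation\<close> says that it is
  additive on every conflation \<open>A \<rightarrow> B \<rightarrow> D\<close> with \<open>A\<close> in \<open>T\<close>: the pullback of \<open>B \<rightarrow> D\<close> along
  \<open>T0 \<rightarrow> D\<close> is an extension of \<open>T0\<close> by \<open>A\<close>, so it splits.  Both facts rest on
  \<open>pullback_conflations\<close>.

  Let now \<open>U\<close> be a second cluster-tilting subcategory.  An object \<open>A\<close> of \<open>T\<close> sits in a conflation
  \<open>A \<rightarrow> U0 \<rightarrow> U1\<close> given by a left approximation, and so \<open>[A]\<close> is the difference of the indices of \<open>U0\<close> and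
  \<open>U1\<close>.  Hence the index maps the free abelian group on \<open>indec U\<close> onto the one on \<open>indec T\<close>,
  which bounds the cardinality of \<open>indec T\<close> by that of \<open>indec U\<close> (\<open>lepoll_of_spanning\<close>).
  Exchanging \<open>T\<close> and \<open>U\<close> gives the reverse bound, and Schroeder--Bernstein the equality.

  For the statement on mutable objects, note that projective objects lie in every cluster-tilting
  subcategory and are never mutable, since a conflation ending in a projective splits.  Under a
  weak cluster structure \<open>mut T\<close> is thus \<open>indec T\<close> without the projectives.  If \<open>indec T\<close> is
  infinite its cardinality does not determine that of this difference; but the index fixes the class of every object
  of \<open>T\<close>, so it also induces a surjection between the quotients by the classes of projectives
  (\<open>lepoll_of_relative_spanning\<close>), and the same argument applies to these.
\<close>

section \<open>Ranks of free abelian groups\<close>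

text \<open>Modulo 2, the value of a homomorphism at \<open>v\<close> depends only on the set of basis elements at which
  \<open>v\<close> has an odd coefficient.\<close>

lemma frag_extend_parity:
  assumes "finite S" "Poly_Mapping.keys v \<subseteq> S"
  shows "even (Poly_Mapping.lookup (frag_extend f v) a -
    (\<Sum>b | b \<in> S \<and> odd (Poly_Mapping.lookup v b). Poly_Mapping.lookup (f b) a))"
proof -
  have l: "Poly_Mapping.lookup (\<Sum>i\<in>I. g i) a = (\<Sum>i\<in>I. Poly_Mapping.lookup (g i) a)" for I and g :: "_ \<Rightarrow> _ \<Rightarrow>\<^sub>0 int"
    by (induction I rule: infinite_finite_induct) (auto simp: lookup_add)
  have "Poly_Mapping.lookup (frag_extend f v) a =
      (\<Sum>b\<in>S. Poly_Mapping.lookup v b * Poly_Mapping.lookup (f b) a)"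
    unfolding frag_extend_def l using assms
    by (intro sum.mono_neutral_cong_left) (auto simp: in_keys_iff)
  also have "\<dots> - (\<Sum>b | b \<in> S \<and> odd (Poly_Mapping.lookup v b). Poly_Mapping.lookup (f b) a) =
      (\<Sum>b\<in>S. (Poly_Mapping.lookup v b - of_bool (odd (Poly_Mapping.lookup v b))) * Poly_Mapping.lookup (f b) a)"
    using assms(1) by (simp add: left_diff_distrib sum_subtractf flip: sum.inter_filter)
       (auto simp: of_bool_def intro!: sum.cong)
  also have "even \<dots>"
    by (intro dvd_sum) auto
  finally show ?thesis .
qed

text \<open>Reduction modulo 2 replaces both free groups by finite power sets: the subset \<open>S\<close> of \<open>B\<close>
  is sent to the set of odd coefficients of the sum of \<open>f\<close> over \<open>S\<close>, and this map is still
  surjective.\<close>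

lemma spanning_finite_card_le:
  fixes f :: "'b \<Rightarrow> 'a \<Rightarrow>\<^sub>0 int"
  assumes "finite A" "finite B"
    and span: "\<And>a. a \<in> A \<Longrightarrow> \<exists>v. Poly_Mapping.keys v \<subseteq> B \<and> frag_extend f v = frag_of a"
  shows "card A \<le> card B"
proof -
  define g where "g S = {a \<in> A. odd (\<Sum>b\<in>S. Poly_Mapping.lookup (f b) a)}" for S
  have "Pow A \<subseteq> g ` Pow B"
  proof
    fix R assume "R \<in> Pow A"
    obtain w where w: "\<And>a. a \<in> A \<Longrightarrow> Poly_Mapping.keys (w a) \<subseteq> B \<and> frag_extend f (w a) = frag_of a"
      using span by metis
    define v where "v = (\<Sum>a\<in>R. w a)"
    have fin: "finite R" using \<open>R \<in> Pow A\<close> assms(1) finite_subset by auto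
    have v: "Poly_Mapping.keys v \<subseteq> B"
      using w \<open>R \<in> Pow A\<close> unfolding v_def by (intro order.trans[OF keys_sum]) auto
    have "frag_extend f v = (\<Sum>a\<in>R. frag_of a)"
      using w \<open>R \<in> Pow A\<close> by (auto simp: v_def frag_extend_sum[OF fin] intro!: sum.cong)
    moreover have "Poly_Mapping.lookup (\<Sum>a\<in>R. frag_of a) x = of_bool (x \<in> R)" for x
      using fin by induction (auto simp: lookup_add)
    ultimately have "odd (Poly_Mapping.lookup (frag_extend f v) x) \<longleftrightarrow> x \<in> R" for x
      by simp
    then have "g {b \<in> B. odd (Poly_Mapping.lookup v b)} = R"
      using frag_extend_parity[OF assms(2) v, of f] \<open>R \<in> Pow A\<close> unfolding g_def by auto
    then show "R \<in> g ` Pow B" by blast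
  qed
  then have "card (Pow A) \<le> card (Pow B)"
    using assms by (meson card_image_le card_mono finite_Pow_iff finite_imageI le_trans)
  then show ?thesis using assms by (simp add: card_Pow)
qed

text \<open>Each \<open>f b\<close> has finite support, and these supports cover \<open>A\<close>.  This settles the case of infinite
  \<open>B\<close> and makes \<open>A\<close> finite when \<open>B\<close> is.\<close>

lemma lepoll_of_spanning:
  fixes f :: "'b \<Rightarrow> 'a \<Rightarrow>\<^sub>0 int"
  assumes span: "\<And>a. a \<in> A \<Longrightarrow> \<exists>v. Poly_Mapping.keys v \<subseteq> B \<and> frag_extend f v = frag_of a"
  shows "A \<lesssim> B"
proof -
  have cover: "A \<subseteq> (\<Union>b\<in>B. Poly_Mapping.keys (f b))"
  proof
    fix a assume "a \<in> A"
    then obtain v where "Poly_Mapping.keys v \<subseteq> B" "frag_extend f v = frag_of a" using span by blast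
    then show "a \<in> (\<Union>b\<in>B. Poly_Mapping.keys (f b))"
      using keys_frag_extend[of f v] by (auto simp: keys_frag_of)
  qed
  show ?thesis
  proof (cases "finite B")
    case True
    then have "finite A" using cover by (meson finite_UN_I finite_keys finite_subset)
    then show ?thesis using True spanning_finite_card_le[OF _ True span] by (simp add: lepoll_iff_card_le)
  next
    case False
    have fin: "Poly_Mapping.keys (f b) \<lesssim> B" for b
      by (rule finite_lepoll_infinite[OF False finite_keys])
    have "(card_of (\<Union>b\<in>B. Poly_Mapping.keys (f b)), card_of B) \<in> ordLeq"
    proof (rule card_of_UNION_ordLeq_infinite[OF False])
      show "(card_of B, card_of B) \<in> ordLeq" by (rule card_of_mono1) simp
      show "\<forall>b\<in>B. (card_of (Poly_Mapping.keys (f b)), card_of B) \<in> ordLeq"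
        using fin unfolding lepoll_def card_of_ordLeq by blast
    qed
    then have "(\<Union>b\<in>B. Poly_Mapping.keys (f b)) \<lesssim> B"
      unfolding lepoll_def card_of_ordLeq .
    then show ?thesis using cover lepoll_trans subset_imp_lepoll by blast
  qed
qed

text \<open>If the homomorphism fixes the elements of \<open>P\<close>, then its image still contains the other elements
  of \<open>A\<close> after those of \<open>P\<close> are set to zero in its source and target.\<close>

lemma lepoll_of_relative_spanning:
  fixes f :: "'a \<Rightarrow> 'a \<Rightarrow>\<^sub>0 int"
  assumes P: "P \<subseteq> B" and fP: "\<And>p. p \<in> P \<Longrightarrow> f p = frag_of p"
    and span: "\<And>a. a \<in> A \<Longrightarrow> \<exists>v. Poly_Mapping.keys v \<subseteq> B \<and> frag_extend f v = frag_of a"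
  shows "A - P \<lesssim> B - P"
proof -
  define r where "r = frag_extend (\<lambda>x. if x \<in> P then 0 else frag_of x)"
  show ?thesis
  proof (rule lepoll_of_spanning)
    fix a assume a: "a \<in> A - P"
    then obtain v where v: "Poly_Mapping.keys v \<subseteq> B" "frag_extend f v = frag_of a" using span by blast
    have "Poly_Mapping.keys v \<subseteq> (B - P) \<union> P" using v(1) by blast
    then obtain d e where de: "Poly_Mapping.keys d \<subseteq> B - P" "Poly_Mapping.keys e \<subseteq> P" "d + e = v"
      by (rule frag_split)
    have comp: "r (frag_extend f x) = frag_extend (r \<circ> f) x" for x
      by (induction x rule: frag_induction[OF subset_UNIV])
        (auto simp: r_def frag_extend_diff)
    have "frag_extend (r \<circ> f) e = 0"
      using de(2) by (intro frag_extend_eq_0) (auto simp: fP r_def)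
    moreover have "r (frag_extend f v) = frag_extend (r \<circ> f) (d + e)"
      by (simp only: comp de(3))
    ultimately have "frag_extend (r \<circ> f) d = r (frag_extend f v)"
      by (simp add: frag_extend_add)
    also have "\<dots> = frag_of a" using a v by (simp add: r_def)
    finally show "\<exists>v. Poly_Mapping.keys v \<subseteq> B - P \<and> frag_extend (r \<circ> f) v = frag_of a"
      using de(1) by blast
  qed
qed


section \<open>Calculus of morphisms\<close>

context linear_category
begin

text \<open>As morphism spaces are disjoint, every morphism has a source and a target, from which the
  addition can recover the space it takes place in.  With \<open>dom\<close> and \<open>cod\<close> as functions,
  typing conditions become equations that the simplifier can solve; the rules below orient
  composition to the right and distribute it over sums.\<close>

definition arrow :: "'m \<Rightarrow> 'o \<Rightarrow> 'o \<Rightarrow> bool" (\<open>\<guillemotleft>_ : _ \<rightarrow> _\<guillemotright>\<close>) where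
  "\<guillemotleft>f : X \<rightarrow> Y\<guillemotright> \<longleftrightarrow> X \<in> Ob C \<and> Y \<in> Ob C \<and> f \<in> mor C X Y"

definition arr :: "'m \<Rightarrow> bool" where
  "arr f \<longleftrightarrow> (\<exists>X Y. \<guillemotleft>f : X \<rightarrow> Y\<guillemotright>)"

definition dom :: "'m \<Rightarrow> 'o" where
  "dom f = (THE X. \<exists>Y. \<guillemotleft>f : X \<rightarrow> Y\<guillemotright>)"

definition cod :: "'m \<Rightarrow> 'o" where
  "cod f = (THE Y. \<exists>X. \<guillemotleft>f : X \<rightarrow> Y\<guillemotright>)"

abbreviation comp :: "'m \<Rightarrow> 'm \<Rightarrow> 'm" (infixr \<open>\<bullet>\<close> 70) where
  "g \<bullet> f \<equiv> cmp C g f"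

abbreviation idm :: "'o \<Rightarrow> 'm" where "idm \<equiv> ident C"

abbreviation nul :: "'o \<Rightarrow> 'o \<Rightarrow> 'm" where "nul \<equiv> zero_mor C"

definition plus_mor :: "'m \<Rightarrow> 'm \<Rightarrow> 'm" (infixl \<open>\<boxplus>\<close> 65) where
  "f \<boxplus> g = f \<oplus>\<^bsub>Hom C (dom f) (cod f)\<^esub> g"

definition minus_mor :: "'m \<Rightarrow> 'm" (\<open>\<boxminus> _\<close> [81] 80) where
  "\<boxminus> f = \<ominus>\<^bsub>Hom C (dom f) (cod f)\<^esub> f"

lemma arrow_unique: "\<lbrakk>\<guillemotleft>f : X \<rightarrow> Y\<guillemotright>; \<guillemotleft>f : X' \<rightarrow> Y'\<guillemotright>\<rbrakk> \<Longrightarrow> X = X' \<and> Y = Y'"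
  unfolding arrow_def using Hom_disjoint by blast

lemma arrow_dom_cod: assumes "\<guillemotleft>f : X \<rightarrow> Y\<guillemotright>" shows "dom f = X" "cod f = Y"
proof -
  show "dom f = X" unfolding dom_def using assms by (rule_tac the_equality) (auto dest: arrow_unique)
  show "cod f = Y" unfolding cod_def using assms by (rule_tac the_equality) (auto dest: arrow_unique)
qed

lemma arrow_iff: "\<guillemotleft>f : X \<rightarrow> Y\<guillemotright> \<longleftrightarrow> X \<in> Ob C \<and> Y \<in> Ob C \<and> arr f \<and> dom f = X \<and> cod f = Y"
proof
  assume f: "\<guillemotleft>f : X \<rightarrow> Y\<guillemotright>"
  then show "X \<in> Ob C \<and> Y \<in> Ob C \<and> arr f \<and> dom f = X \<and> cod f = Y"
    using arrow_dom_cod[OF f] by (auto simp: arr_def arrow_def)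
next
  assume *: "X \<in> Ob C \<and> Y \<in> Ob C \<and> arr f \<and> dom f = X \<and> cod f = Y"
  then obtain X' Y' where f: "\<guillemotleft>f : X' \<rightarrow> Y'\<guillemotright>" unfolding arr_def by blast
  then show "\<guillemotleft>f : X \<rightarrow> Y\<guillemotright>" using arrow_dom_cod[OF f] * by simp
qed

lemma arrI: "\<lbrakk>X \<in> Ob C; Y \<in> Ob C; f \<in> mor C X Y\<rbrakk> \<Longrightarrow> arr f \<and> dom f = X \<and> cod f = Y"
  using arrow_iff[of f X Y] arrow_def[of f X Y] by blast

lemma mor_iff: "\<lbrakk>X \<in> Ob C; Y \<in> Ob C\<rbrakk> \<Longrightarrow> f \<in> mor C X Y \<longleftrightarrow> arr f \<and> dom f = X \<and> cod f = Y"
  using arrow_iff[of f X Y] arrow_def[of f X Y] by blast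

lemma dom_Ob [simp]: "arr f \<Longrightarrow> dom f \<in> Ob C"
  and cod_Ob [simp]: "arr f \<Longrightarrow> cod f \<in> Ob C"
  by (auto simp: arr_def arrow_dom_cod arrow_def)

lemma comp_arr [simp]:
  assumes "arr f" "arr g" "cod f = dom g"
  shows "arr (g \<bullet> f)" "dom (g \<bullet> f) = dom f" "cod (g \<bullet> f) = cod g"
  using arrI[of "dom f" "cod g" "g \<bullet> f"] cmp_closed[of "dom f" "cod f" "cod g" f g] assms
  by (simp_all add: mor_iff)

lemma idm_arr [simp]:
  assumes "X \<in> Ob C" shows "arr (idm X)" "dom (idm X) = X" "cod (idm X) = X"
  using arrI[OF _ _ ident_closed] assms by simp_all

lemma comp_assoc [simp]:
  "\<lbrakk>arr f; arr g; arr h; cod f = dom g; cod g = dom h\<rbrakk> \<Longrightarrow> (h \<bullet> g) \<bullet> f = h \<bullet> (g \<bullet> f)"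
  by (rule cmp_assoc[of "dom f" "cod f" "cod g" "cod h"]) (simp_all add: mor_iff)

lemma comp_idm [simp]:
  shows "\<lbrakk>arr f; cod f = Y\<rbrakk> \<Longrightarrow> idm Y \<bullet> f = f"
    and "\<lbrakk>arr f; dom f = X\<rbrakk> \<Longrightarrow> f \<bullet> idm X = f"
  using cmp_ident_left[of "dom f" "cod f" f] cmp_ident_right[of "dom f" "cod f" f]
  by (auto simp: mor_iff)

lemma Hom_abelian_group: "\<lbrakk>X \<in> Ob C; Y \<in> Ob C\<rbrakk> \<Longrightarrow> abelian_group (Hom C X Y)"
  using Hom_module module.axioms(2) by blast

lemma nul_arr [simp]:
  assumes "X \<in> Ob C" "Y \<in> Ob C" shows "arr (nul X Y)" "dom (nul X Y) = X" "cod (nul X Y) = Y"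
  using arrI[of X Y "nul X Y"] Hom_abelian_group[OF assms] assms
  by (auto intro: abelian_monoid.zero_closed abelian_group.axioms)

lemma plus_arr [simp]:
  assumes "arr f" "arr g" "dom g = dom f" "cod g = cod f"
  shows "arr (f \<boxplus> g)" "dom (f \<boxplus> g) = dom f" "cod (f \<boxplus> g) = cod f"
proof -
  interpret abelian_group "Hom C (dom f) (cod f)" by (rule Hom_abelian_group) (use assms in auto)
  have "f \<boxplus> g \<in> mor C (dom f) (cod f)" using a_closed[of f g] assms by (simp add: plus_mor_def mor_iff)
  then show "arr (f \<boxplus> g)" "dom (f \<boxplus> g) = dom f" "cod (f \<boxplus> g) = cod f"
    using assms by (simp_all add: mor_iff)
qed

lemma minus_arr [simp]:
  assumes "arr f"
  shows "arr (\<boxminus> f)" "dom (\<boxminus> f) = dom f" "cod (\<boxminus> f) = cod f"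
  using abelian_group.a_inv_closed[OF Hom_abelian_group[of "dom f" "cod f"], of f] assms
    arrI[of "dom f" "cod f" "\<boxminus> f"]
  by (simp_all add: minus_mor_def mor_iff)

lemma plus_eq: "\<lbrakk>arr f; dom f = X; cod f = Y\<rbrakk> \<Longrightarrow> f \<oplus>\<^bsub>Hom C X Y\<^esub> g = f \<boxplus> g"
  by (simp add: plus_mor_def)

lemma plus_assoc:
  assumes "arr f" "arr g" "arr h" "dom g = dom f" "cod g = cod f" "dom h = dom f" "cod h = cod f"
  shows "(f \<boxplus> g) \<boxplus> h = f \<boxplus> (g \<boxplus> h)"
proof -
  interpret abelian_group "Hom C (dom f) (cod f)" by (rule Hom_abelian_group) (use assms in auto)
  show ?thesis using a_assoc[of f g h] assms by (simp add: mor_iff plus_eq)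
qed

lemma plus_commute:
  assumes "arr f" "arr g" "dom g = dom f" "cod g = cod f"
  shows "f \<boxplus> g = g \<boxplus> f"
proof -
  interpret abelian_group "Hom C (dom f) (cod f)" by (rule Hom_abelian_group) (use assms in auto)
  show ?thesis using a_comm[of f g] assms by (simp add: plus_mor_def mor_iff)
qed

lemma plus_nul [simp]:
  assumes "arr f" "dom f = X" "cod f = Y"
  shows "f \<boxplus> nul X Y = f" "nul X Y \<boxplus> f = f"
proof -
  interpret abelian_group "Hom C (dom f) (cod f)" by (rule Hom_abelian_group) (use assms in auto)
  have "f \<boxplus> nul (dom f) (cod f) = f" using r_zero[of f] assms(1) by (simp add: plus_mor_def mor_iff)
  then show "f \<boxplus> nul X Y = f" "nul X Y \<boxplus> f = f"
    using assms plus_commute[of f "nul X Y"] by auto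
qed

lemma plus_minus [simp]:
  assumes "arr f"
  shows "f \<boxplus> (\<boxminus> f) = nul (dom f) (cod f)" "(\<boxminus> f) \<boxplus> f = nul (dom f) (cod f)"
proof -
  interpret abelian_group "Hom C (dom f) (cod f)" by (rule Hom_abelian_group) (use assms in auto)
  show *: "f \<boxplus> (\<boxminus> f) = nul (dom f) (cod f)"
    using r_neg[of f] assms by (simp add: plus_mor_def minus_mor_def mor_iff)
  show "(\<boxminus> f) \<boxplus> f = nul (dom f) (cod f)" using plus_commute[of f "\<boxminus> f"] assms * by simp
qed

lemma plus_cancel:
  assumes "f \<boxplus> g = f \<boxplus> h" "arr f" "arr g" "arr h" "dom g = dom f" "cod g = cod f" "dom h = dom f" "cod h = cod f"
  shows "g = h"
proof -
  have "(\<boxminus> f) \<boxplus> (f \<boxplus> g) = (\<boxminus> f) \<boxplus> (f \<boxplus> h)" using assms(1) by simp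
  then show ?thesis using assms(2-) by (simp add: plus_assoc[symmetric])
qed

lemma comp_plus_right [simp]:
  assumes "arr f" "arr g" "arr h" "dom g = dom f" "cod g = cod f" "dom h = cod f"
  shows "h \<bullet> (f \<boxplus> g) = h \<bullet> f \<boxplus> h \<bullet> g"
  using cmp_linear_right[of "dom f" "cod f" "cod h" h] assms
  by (simp add: linear_map_def mor_iff plus_eq)

lemma comp_plus_left [simp]:
  assumes "arr f" "arr g" "arr h" "dom g = dom f" "cod g = cod f" "cod h = dom f"
  shows "(f \<boxplus> g) \<bullet> h = f \<bullet> h \<boxplus> g \<bullet> h"
  using cmp_linear_left[of "dom h" "dom f" "cod f" h] assms
  by (simp add: linear_map_def mor_iff plus_eq)

lemma plus_self_nul:
  assumes "f \<boxplus> f = f" "arr f" shows "f = nul (dom f) (cod f)"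
proof (rule plus_cancel[of f])
  show "f \<boxplus> f = f \<boxplus> nul (dom f) (cod f)" using assms by simp
qed (use assms in auto)

lemma comp_nul [simp]:
  shows "\<lbrakk>arr f; cod f = X; Y \<in> Ob C\<rbrakk> \<Longrightarrow> nul X Y \<bullet> f = nul (dom f) Y"
    and "\<lbrakk>arr f; dom f = Y; X \<in> Ob C\<rbrakk> \<Longrightarrow> f \<bullet> nul X Y = nul X (cod f)"
proof -
  assume *: "arr f" "cod f = X" "Y \<in> Ob C"
  then have **: "X \<in> Ob C" by auto
  have "nul X Y \<bullet> f \<boxplus> nul X Y \<bullet> f = (nul X Y \<boxplus> nul X Y) \<bullet> f" using * ** by (simp del: plus_nul)
  then have "nul X Y \<bullet> f \<boxplus> nul X Y \<bullet> f = nul X Y \<bullet> f" using * ** by simp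
  then show "nul X Y \<bullet> f = nul (dom f) Y" using plus_self_nul[of "nul X Y \<bullet> f"] * ** by simp
next
  assume *: "arr f" "dom f = Y" "X \<in> Ob C"
  then have **: "Y \<in> Ob C" by auto
  have "f \<bullet> nul X Y \<boxplus> f \<bullet> nul X Y = f \<bullet> (nul X Y \<boxplus> nul X Y)" using * ** by (simp del: plus_nul)
  then have "f \<bullet> nul X Y \<boxplus> f \<bullet> nul X Y = f \<bullet> nul X Y" using * ** by simp
  then show "f \<bullet> nul X Y = nul X (cod f)" using plus_self_nul[of "f \<bullet> nul X Y"] * ** by simp
qed

lemma minus_unique:
  assumes "f \<boxplus> g = nul (dom f) (cod f)" "arr f" "arr g" "dom g = dom f" "cod g = cod f"
  shows "g = \<boxminus> f"
  by (rule plus_cancel[of f]) (use assms in auto)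

lemma minus_nul [simp]: "\<lbrakk>X \<in> Ob C; Y \<in> Ob C\<rbrakk> \<Longrightarrow> \<boxminus> nul X Y = nul X Y"
  using minus_unique[of "nul X Y" "nul X Y"] by simp

lemma comp_minus [simp]:
  assumes "arr f" "arr g" "cod f = dom g"
  shows "g \<bullet> (\<boxminus> f) = \<boxminus> (g \<bullet> f)" "(\<boxminus> g) \<bullet> f = \<boxminus> (g \<bullet> f)"
proof -
  have "g \<bullet> f \<boxplus> g \<bullet> (\<boxminus> f) = g \<bullet> (f \<boxplus> (\<boxminus> f))" "g \<bullet> f \<boxplus> (\<boxminus> g) \<bullet> f = (g \<boxplus> (\<boxminus> g)) \<bullet> f"
    using assms by (simp_all del: plus_minus)
  then show "g \<bullet> (\<boxminus> f) = \<boxminus> (g \<bullet> f)" "(\<boxminus> g) \<bullet> f = \<boxminus> (g \<bullet> f)"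
    using assms by (auto intro: minus_unique)
qed

text \<open>This turns an equation \<open>g \<bullet> f = k\<close> into a rewrite rule that also applies inside compositions
  associated to the right.\<close>

lemma comp_reduce:
  assumes "g \<bullet> f = k" "arr f" "arr g" "cod f = dom g" "arr h" "cod h = dom f"
  shows "g \<bullet> f \<bullet> h = k \<bullet> h"
  using comp_assoc[of h f g] assms by simp

lemma is_iso_iff:
  "is_iso C X Y f \<longleftrightarrow> \<guillemotleft>f : X \<rightarrow> Y\<guillemotright> \<and> (\<exists>g. \<guillemotleft>g : Y \<rightarrow> X\<guillemotright> \<and> g \<bullet> f = idm X \<and> f \<bullet> g = idm Y)"
  by (auto simp: is_iso_def arrow_def)

lemma is_isoI: "\<lbrakk>\<guillemotleft>f : X \<rightarrow> Y\<guillemotright>; \<guillemotleft>g : Y \<rightarrow> X\<guillemotright>; g \<bullet> f = idm X; f \<bullet> g = idm Y\<rbrakk> \<Longrightarrow> is_iso C X Y f"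
  using is_iso_iff by blast

lemma is_iso_idm: "X \<in> Ob C \<Longrightarrow> is_iso C X X (idm X)"
  by (rule is_isoI[where g = "idm X"]) (simp_all add: arrow_iff)

lemma is_iso_comp:
  assumes "is_iso C X Y f" "is_iso C Y Z g" shows "is_iso C X Z (g \<bullet> f)"
proof -
  obtain f' g' where *: "\<guillemotleft>f' : Y \<rightarrow> X\<guillemotright>" "f' \<bullet> f = idm X" "f \<bullet> f' = idm Y"
    "\<guillemotleft>g' : Z \<rightarrow> Y\<guillemotright>" "g' \<bullet> g = idm Y" "g \<bullet> g' = idm Z" "\<guillemotleft>f : X \<rightarrow> Y\<guillemotright>" "\<guillemotleft>g : Y \<rightarrow> Z\<guillemotright>"
    using assms unfolding is_iso_iff by blast
  have r: "g' \<bullet> g \<bullet> f = f" "f \<bullet> f' \<bullet> g' = g'"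
    using * comp_reduce[of g' g "idm Y" f] comp_reduce[of f f' "idm Y" g'] by (simp_all add: arrow_iff)
  show ?thesis by (rule is_isoI[where g = "f' \<bullet> g'"]) (use * r in \<open>simp_all add: arrow_iff\<close>)
qed

lemma isomorphic_refl: "X \<in> Ob C \<Longrightarrow> isomorphic C X X"
  unfolding isomorphic_def using is_iso_idm by blast

lemma isomorphic_sym: "isomorphic C X Y \<Longrightarrow> isomorphic C Y X"
  unfolding isomorphic_def is_iso_iff by blast

lemma isomorphic_trans: "\<lbrakk>isomorphic C X Y; isomorphic C Y Z\<rbrakk> \<Longrightarrow> isomorphic C X Z"
  unfolding isomorphic_def using is_iso_comp by blast

lemma isomorphic_Ob: "isomorphic C X Y \<Longrightarrow> X \<in> Ob C \<and> Y \<in> Ob C"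
  unfolding isomorphic_def is_iso_def by blast

lemma iso_rep_isomorphic: "X \<in> Ob C \<Longrightarrow> isomorphic C X (iso_rep C X)"
  unfolding iso_rep_def by (rule someI[of "isomorphic C X"]) (rule isomorphic_refl)

lemma iso_rep_eq_iff:
  assumes "X \<in> Ob C" "Y \<in> Ob C"
  shows "iso_rep C X = iso_rep C Y \<longleftrightarrow> isomorphic C X Y"
proof
  assume "isomorphic C X Y"
  then have "isomorphic C X = isomorphic C Y" using isomorphic_sym isomorphic_trans by blast
  then show "iso_rep C X = iso_rep C Y" unfolding iso_rep_def by simp
next
  assume *: "iso_rep C X = iso_rep C Y"
  have "isomorphic C X (iso_rep C Y)" using iso_rep_isomorphic[OF assms(1)] * by simp
  then show "isomorphic C X Y" using iso_rep_isomorphic[OF assms(2)] isomorphic_sym isomorphic_trans by blast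
qed

end


section \<open>Biproducts\<close>

context linear_category
begin

lemma biproduct_iff:
  "is_biproduct C S X Y i j p q \<longleftrightarrow>
    \<guillemotleft>i : X \<rightarrow> S\<guillemotright> \<and> \<guillemotleft>j : Y \<rightarrow> S\<guillemotright> \<and> \<guillemotleft>p : S \<rightarrow> X\<guillemotright> \<and> \<guillemotleft>q : S \<rightarrow> Y\<guillemotright> \<and>
    p \<bullet> i = idm X \<and> q \<bullet> j = idm Y \<and> q \<bullet> i = nul X Y \<and> p \<bullet> j = nul Y X \<and> i \<bullet> p \<boxplus> j \<bullet> q = idm S"
  by (auto simp: is_biproduct_def arrow_iff mor_iff plus_eq)

lemma biproductD:
  assumes "is_biproduct C S X Y i j p q"
  shows "S \<in> Ob C" "X \<in> Ob C" "Y \<in> Ob C"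
    "arr i" "dom i = X" "cod i = S" "arr j" "dom j = Y" "cod j = S"
    "arr p" "dom p = S" "cod p = X" "arr q" "dom q = S" "cod q = Y"
    "p \<bullet> i = idm X" "q \<bullet> j = idm Y" "q \<bullet> i = nul X Y" "p \<bullet> j = nul Y X"
    "\<And>h. \<lbrakk>arr h; cod h = X\<rbrakk> \<Longrightarrow> p \<bullet> i \<bullet> h = h" "\<And>h. \<lbrakk>arr h; cod h = Y\<rbrakk> \<Longrightarrow> q \<bullet> j \<bullet> h = h"
    "\<And>h. \<lbrakk>arr h; cod h = X\<rbrakk> \<Longrightarrow> q \<bullet> i \<bullet> h = nul (dom h) Y"
    "\<And>h. \<lbrakk>arr h; cod h = Y\<rbrakk> \<Longrightarrow> p \<bullet> j \<bullet> h = nul (dom h) X"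
proof -
  note * = assms[unfolded biproduct_iff arrow_iff]
  show "S \<in> Ob C" "X \<in> Ob C" "Y \<in> Ob C"
    "arr i" "dom i = X" "cod i = S" "arr j" "dom j = Y" "cod j = S"
    "arr p" "dom p = S" "cod p = X" "arr q" "dom q = S" "cod q = Y"
    "p \<bullet> i = idm X" "q \<bullet> j = idm Y" "q \<bullet> i = nul X Y" "p \<bullet> j = nul Y X"
    using * by simp_all
  fix h assume h: "arr h"
  show "cod h = X \<Longrightarrow> p \<bullet> i \<bullet> h = h" "cod h = Y \<Longrightarrow> q \<bullet> j \<bullet> h = h"
    "cod h = X \<Longrightarrow> q \<bullet> i \<bullet> h = nul (dom h) Y" "cod h = Y \<Longrightarrow> p \<bullet> j \<bullet> h = nul (dom h) X"
    using * h comp_reduce[of p i "idm X" h] comp_reduce[of q j "idm Y" h]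
      comp_reduce[of q i "nul X Y" h] comp_reduce[of p j "nul Y X" h] by simp_all
qed

lemma biproduct_decomp:
  assumes "is_biproduct C S X Y i j p q" "arr h" "cod h = S"
  shows "i \<bullet> p \<bullet> h \<boxplus> j \<bullet> q \<bullet> h = h"
proof -
  note [simp] = biproductD[OF assms(1)]
  have "(i \<bullet> p \<boxplus> j \<bullet> q) \<bullet> h = h"
    using assms by (simp add: biproduct_iff del: comp_plus_left)
  then show ?thesis using assms(2,3) by simp
qed

lemma biproduct_jointly_monic:
  assumes "is_biproduct C S X Y i j p q" "arr f" "cod f = S" "arr g" "cod g = S"
    and "p \<bullet> f = p \<bullet> g" "q \<bullet> f = q \<bullet> g"
  shows "f = g"
proof -
  have "f = i \<bullet> p \<bullet> f \<boxplus> j \<bullet> q \<bullet> f" by (rule biproduct_decomp[OF assms(1-3), symmetric])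
  also have "\<dots> = g" unfolding assms(6,7) by (rule biproduct_decomp[OF assms(1,4,5)])
  finally show ?thesis .
qed

text \<open>Joint monicity of the projections can replace the equation \<open>i \<bullet> p \<boxplus> j \<bullet> q = 1\<close>, since both
  sides have the same components.\<close>

lemma biproductI:
  assumes "\<guillemotleft>i : X \<rightarrow> S\<guillemotright>" "\<guillemotleft>j : Y \<rightarrow> S\<guillemotright>" "\<guillemotleft>p : S \<rightarrow> X\<guillemotright>" "\<guillemotleft>q : S \<rightarrow> Y\<guillemotright>"
    "p \<bullet> i = idm X" "q \<bullet> j = idm Y" "q \<bullet> i = nul X Y" "p \<bullet> j = nul Y X"
    and monic: "\<And>f g. \<lbrakk>\<guillemotleft>f : S \<rightarrow> S\<guillemotright>; \<guillemotleft>g : S \<rightarrow> S\<guillemotright>; p \<bullet> f = p \<bullet> g; q \<bullet> f = q \<bullet> g\<rbrakk> \<Longrightarrow> f = g"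
  shows "is_biproduct C S X Y i j p q"
proof -
  have "i \<bullet> p \<boxplus> j \<bullet> q = idm S"
    using assms(1-8) comp_reduce[of p i "idm X" p] comp_reduce[of q j "idm Y" q]
      comp_reduce[of q i "nul X Y" p] comp_reduce[of p j "nul Y X" q]
    by (rule_tac monic) (simp_all add: arrow_iff)
  then show ?thesis using assms(1-8) by (simp add: biproduct_iff)
qed

lemma biproduct_swap:
  assumes "is_biproduct C S X Y i j p q" shows "is_biproduct C S Y X j i q p"
proof -
  note [simp] = biproductD[OF assms]
  show ?thesis using assms plus_commute[of "i \<bullet> p" "j \<bullet> q"] by (simp add: biproduct_iff)
qed

lemma direct_sum_swap: "direct_sum C S X Y \<Longrightarrow> direct_sum C S Y X"
  unfolding direct_sum_def using biproduct_swap by blast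

lemma direct_sum_Ob: "direct_sum C S X Y \<Longrightarrow> S \<in> Ob C \<and> X \<in> Ob C \<and> Y \<in> Ob C"
  unfolding direct_sum_def is_biproduct_def by blast

definition inverse_arrows :: "'o \<Rightarrow> 'o \<Rightarrow> 'm \<Rightarrow> 'm \<Rightarrow> bool" where
  "inverse_arrows X Y f g \<longleftrightarrow> \<guillemotleft>f : X \<rightarrow> Y\<guillemotright> \<and> \<guillemotleft>g : Y \<rightarrow> X\<guillemotright> \<and> g \<bullet> f = idm X \<and> f \<bullet> g = idm Y"

lemma is_iso_inverse: "is_iso C X Y f \<longleftrightarrow> (\<exists>g. inverse_arrows X Y f g)"
  unfolding is_iso_iff inverse_arrows_def by blast

lemma isomorphic_inverse: "isomorphic C X Y \<longleftrightarrow> (\<exists>f g. inverse_arrows X Y f g)"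
  unfolding isomorphic_def is_iso_inverse by blast

lemma inverse_arrowsD:
  assumes "inverse_arrows X Y f g"
  shows "X \<in> Ob C" "Y \<in> Ob C" "arr f" "dom f = X" "cod f = Y" "arr g" "dom g = Y" "cod g = X"
    "g \<bullet> f = idm X" "f \<bullet> g = idm Y"
    "\<And>h. \<lbrakk>arr h; cod h = X\<rbrakk> \<Longrightarrow> g \<bullet> f \<bullet> h = h" "\<And>h. \<lbrakk>arr h; cod h = Y\<rbrakk> \<Longrightarrow> f \<bullet> g \<bullet> h = h"
proof -
  note * = assms[unfolded inverse_arrows_def arrow_iff]
  show "X \<in> Ob C" "Y \<in> Ob C" "arr f" "dom f = X" "cod f = Y" "arr g" "dom g = Y" "cod g = X"
    "g \<bullet> f = idm X" "f \<bullet> g = idm Y"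
    using * by simp_all
  fix h assume h: "arr h"
  show "cod h = X \<Longrightarrow> g \<bullet> f \<bullet> h = h" "cod h = Y \<Longrightarrow> f \<bullet> g \<bullet> h = h"
    using * h comp_reduce[of g f "idm X" h] comp_reduce[of f g "idm Y" h] by simp_all
qed

lemma biproduct_iso:
  assumes "is_biproduct C S X Y i j p q"
    and "inverse_arrows S S' s s'" "inverse_arrows X X' a a'" "inverse_arrows Y Y' b b'"
  shows "is_biproduct C S' X' Y' (s \<bullet> i \<bullet> a') (s \<bullet> j \<bullet> b') (a \<bullet> p \<bullet> s') (b \<bullet> q \<bullet> s')"
proof -
  note [simp] = biproductD[OF assms(1)] inverse_arrowsD[OF assms(2)] inverse_arrowsD[OF assms(3)]
    inverse_arrowsD[OF assms(4)]
  have "s \<bullet> (i \<bullet> p \<bullet> s' \<boxplus> j \<bullet> q \<bullet> s') = s \<bullet> s'"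
    using biproduct_decomp[OF assms(1), of s'] by (simp del: comp_plus_right)
  then have "s \<bullet> i \<bullet> p \<bullet> s' \<boxplus> s \<bullet> j \<bullet> q \<bullet> s' = idm S'" by simp
  then show ?thesis by (simp add: biproduct_iff arrow_iff)
qed

lemma direct_sum_iso:
  assumes "direct_sum C S X Y" "isomorphic C S S'" "isomorphic C X X'" "isomorphic C Y Y'"
  shows "direct_sum C S' X' Y'"
  using assms unfolding direct_sum_def isomorphic_inverse by (meson biproduct_iso)

lemma zero_object_iff: "zero_object C Z \<longleftrightarrow> Z \<in> Ob C \<and> idm Z = nul Z Z"
  by (simp add: zero_object_def)

lemma zero_object_dom:
  assumes "arr f" "zero_object C (dom f)" shows "f = nul (dom f) (cod f)"
proof -
  have "f \<bullet> idm (dom f) = f \<bullet> nul (dom f) (dom f)" using assms zero_object_iff by simp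
  then show ?thesis using assms by simp
qed

lemma zero_object_cod:
  assumes "arr f" "zero_object C (cod f)" shows "f = nul (dom f) (cod f)"
proof -
  have "idm (cod f) \<bullet> f = nul (cod f) (cod f) \<bullet> f" using assms zero_object_iff by simp
  then show ?thesis using assms by simp
qed

lemma zero_object_retract:
  assumes "zero_object C S" "arr i" "arr p" "dom i = X" "cod i = S" "dom p = S" "cod p = X" "p \<bullet> i = idm X"
  shows "zero_object C X"
proof -
  have [simp]: "X \<in> Ob C" using assms(2,4) dom_Ob by blast
  have "p = nul S X" using zero_object_dom[of p] assms by simp
  then have "idm X = nul X X" using assms by (metis comp_nul(1) \<open>X \<in> Ob C\<close>)
  then show ?thesis by (simp add: zero_object_iff)
qed

lemma zero_object_summand:
  assumes "direct_sum C S X Y" "zero_object C S" shows "zero_object C X" "zero_object C Y"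
proof -
  obtain i j p q where b: "is_biproduct C S X Y i j p q" using assms unfolding direct_sum_def by blast
  note [simp] = biproductD[OF b]
  show "zero_object C X" by (rule zero_object_retract[OF assms(2), of i p]) simp_all
  show "zero_object C Y" by (rule zero_object_retract[OF assms(2), of j q]) simp_all
qed

lemma zero_object_isomorphic: "\<lbrakk>zero_object C Z; isomorphic C Z Z'\<rbrakk> \<Longrightarrow> zero_object C Z'"
  unfolding isomorphic_inverse using zero_object_retract inverse_arrowsD by metis

lemma direct_sum_zero_right:
  assumes b: "is_biproduct C S X Y i j p q" and "zero_object C Y"
  shows "inverse_arrows X S i p"
proof -
  note [simp] = biproductD[OF b]
  have "q = nul S Y" using zero_object_cod[of q] assms(2) by simp
  then have "j \<bullet> q = nul S S" by simp
  then show ?thesis using b by (simp add: inverse_arrows_def biproduct_iff)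
qed

lemma direct_sum_zero:
  assumes "X \<in> Ob C" "zero_object C Z"
  shows "is_biproduct C X X Z (idm X) (nul Z X) (idm X) (nul X Z)"
    "is_biproduct C X Z X (nul Z X) (idm X) (nul X Z) (idm X)"
  using assms by (simp_all add: biproduct_iff arrow_iff zero_object_iff)

end

text \<open>A summand \<open>X\<close> of \<open>R\<close> is a summand of \<open>S = Y \<oplus> R\<close> with complement \<open>Y \<oplus> Z\<close>.  The inclusion and
  projection of \<open>X\<close> are made explicit, as the exchange argument below composes with them.\<close>

lemma (in additive_category) biproduct_rotate:
  assumes b: "is_biproduct C S Y R i j p q" and c: "is_biproduct C R X Z i' j' p' q'"
  shows "\<exists>W k l. direct_sum C W Y Z \<and> is_biproduct C S X W (j \<bullet> i') k (p' \<bullet> q) l"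
proof -
  note [simp] = biproductD[OF b] biproductD[OF c]
  obtain W i2 j2 p2 q2 where w: "is_biproduct C W Y Z i2 j2 p2 q2"
    using biproduct_exists[of Y Z] unfolding direct_sum_def by auto
  note [simp] = biproductD[OF w]
  have "is_biproduct C S X W (j \<bullet> i') (i \<bullet> p2 \<boxplus> j \<bullet> j' \<bullet> q2) (p' \<bullet> q) (i2 \<bullet> p \<boxplus> j2 \<bullet> q' \<bullet> q)"
  proof (rule biproductI)
    show "(i2 \<bullet> p \<boxplus> j2 \<bullet> q' \<bullet> q) \<bullet> (i \<bullet> p2 \<boxplus> j \<bullet> j' \<bullet> q2) = idm W"
      using w by (simp add: biproduct_iff)
    fix f g assume f: "\<guillemotleft>f : S \<rightarrow> S\<guillemotright>" and g: "\<guillemotleft>g : S \<rightarrow> S\<guillemotright>"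
      and e: "(p' \<bullet> q) \<bullet> f = (p' \<bullet> q) \<bullet> g"
        "(i2 \<bullet> p \<boxplus> j2 \<bullet> q' \<bullet> q) \<bullet> f = (i2 \<bullet> p \<boxplus> j2 \<bullet> q' \<bullet> q) \<bullet> g"
    note [simp] = f[unfolded arrow_iff] g[unfolded arrow_iff]
    have "p2 \<bullet> (i2 \<bullet> p \<boxplus> j2 \<bullet> q' \<bullet> q) \<bullet> f = p2 \<bullet> (i2 \<bullet> p \<boxplus> j2 \<bullet> q' \<bullet> q) \<bullet> g"
      "q2 \<bullet> (i2 \<bullet> p \<boxplus> j2 \<bullet> q' \<bullet> q) \<bullet> f = q2 \<bullet> (i2 \<bullet> p \<boxplus> j2 \<bullet> q' \<bullet> q) \<bullet> g"
      using e(2) by simp_all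
    then have e2: "p \<bullet> f = p \<bullet> g" "q' \<bullet> q \<bullet> f = q' \<bullet> q \<bullet> g" by simp_all
    moreover have "q \<bullet> f = q \<bullet> g"
      using e(1) e2(2) by (intro biproduct_jointly_monic[OF c, of "q \<bullet> f" "q \<bullet> g"]) simp_all
    ultimately show "f = g" by (intro biproduct_jointly_monic[OF b, of f g]) simp_all
  qed (simp_all add: arrow_iff)
  then show ?thesis using w unfolding direct_sum_def by blast
qed

context additive_category
begin

text \<open>The two ways of bracketing three summands; \<open>biproduct_rotate\<close> applies after swapping the
  summands of both sums.\<close>

lemma direct_sum_assoc:
  assumes "direct_sum C S R Z" "direct_sum C R X Y"
  shows "\<exists>W. direct_sum C W Y Z \<and> direct_sum C S X W"
  using assms biproduct_rotate direct_sum_swap unfolding direct_sum_def by metis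

lemma direct_sum_list_isomorphic:
  assumes "direct_sum_list C S Xs" "isomorphic C S S'" shows "direct_sum_list C S' Xs"
proof (cases Xs)
  case Nil
  then show ?thesis using assms zero_object_isomorphic by simp
next
  case (Cons X Ys)
  then obtain R where R: "direct_sum C S X R" "direct_sum_list C R Ys" using assms(1) by auto
  then have "direct_sum C S' X R" using direct_sum_iso[OF R(1) assms(2)] direct_sum_Ob[OF R(1)] isomorphic_refl by blast
  then show ?thesis using R(2) Cons by auto
qed

lemma direct_sum_list_append:
  "\<lbrakk>direct_sum C S X Y; direct_sum_list C X Xs; direct_sum_list C Y Ys\<rbrakk> \<Longrightarrow> direct_sum_list C S (Xs @ Ys)"
proof (induction Xs arbitrary: S X)
  case Nil
  then have "isomorphic C Y S"
    using direct_sum_zero_right isomorphic_inverse direct_sum_swap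
    unfolding direct_sum_def by (metis direct_sum_list.simps(1))
  then show ?case using Nil direct_sum_list_isomorphic by simp
next
  case (Cons A Xs)
  then obtain X' where X': "direct_sum C X A X'" "direct_sum_list C X' Xs" by auto
  then obtain W where "direct_sum C W X' Y" "direct_sum C S A W"
    using direct_sum_assoc[OF Cons.prems(1) X'(1)] by blast
  then show ?case using Cons.IH[of W X'] X'(2) Cons.prems(3) by auto
qed

end


section \<open>Krull--Schmidt decompositions\<close>

context linear_category
begin

text \<open>Gaussian elimination: an isomorphism \<open>X \<oplus> S1 \<rightarrow> X' \<oplus> S2\<close> whose entry \<open>X \<rightarrow> X'\<close> is invertible
  has as Schur complement an isomorphism \<open>S1 \<rightarrow> S2\<close>.  Its inverse is the entry \<open>S2 \<rightarrow> S1\<close> of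
  the inverse matrix.\<close>

lemma biproduct_cancel:
  assumes b: "is_biproduct C S X S1 i j p q" and b': "is_biproduct C S X' S2 i' j' p' q'"
    and iso: "is_iso C X X' (p' \<bullet> i)"
  shows "isomorphic C S1 S2"
proof -
  obtain u where u: "inverse_arrows X X' (p' \<bullet> i) u" using iso is_iso_inverse by blast
  note [simp] = biproductD[OF b] biproductD[OF b']
  have [simp]: "arr u" "dom u = X'" "cod u = X" using inverse_arrowsD[OF u] by blast+
  have u1 [simp]: "u \<bullet> p' \<bullet> i = idm X" "p' \<bullet> i \<bullet> u = idm X'"
    "\<And>h. \<lbrakk>arr h; cod h = X\<rbrakk> \<Longrightarrow> u \<bullet> p' \<bullet> i \<bullet> h = h" "\<And>h. \<lbrakk>arr h; cod h = X'\<rbrakk> \<Longrightarrow> p' \<bullet> i \<bullet> u \<bullet> h = h"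
    using inverse_arrowsD[OF u] by simp_all
  \<comment> \<open>The projection of \<open>S\<close> onto the kernel of \<open>p'\<close> along the image of \<open>i\<close>.\<close>
  define e where "e = idm S \<boxplus> (\<boxminus> (i \<bullet> u \<bullet> p'))"
  have [simp]: "arr e" "dom e = S" "cod e = S" by (simp_all add: e_def)
  have pe: "p' \<bullet> e = nul S X'" and ei: "e \<bullet> i = nul X S" by (simp_all add: e_def)
  have qe: "q \<bullet> e = q" and ej: "e \<bullet> j' = j'" by (simp_all add: e_def)
  have [simp]: "q \<bullet> e \<bullet> h = q \<bullet> h" "p' \<bullet> e \<bullet> h = nul (dom h) X'" if "arr h" "cod h = S" for h
    using that comp_reduce[OF qe, of h] comp_reduce[OF pe, of h] by simp_all
  have [simp]: "e \<bullet> i \<bullet> h = nul (dom h) S" if "arr h" "cod h = X" for h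
    using that comp_reduce[OF ei, of h] by simp
  have "(q \<bullet> j') \<bullet> (q' \<bullet> e \<bullet> j) = q \<bullet> (i' \<bullet> p' \<bullet> (e \<bullet> j) \<boxplus> j' \<bullet> q' \<bullet> (e \<bullet> j))" by simp
  also have "\<dots> = idm S1" by (subst biproduct_decomp[OF b']) simp_all
  finally have 1: "(q \<bullet> j') \<bullet> (q' \<bullet> e \<bullet> j) = idm S1" .
  have "(q' \<bullet> e \<bullet> j) \<bullet> (q \<bullet> j') = q' \<bullet> e \<bullet> (i \<bullet> p \<bullet> j' \<boxplus> j \<bullet> q \<bullet> j')" by simp
  also have "\<dots> = idm S2" by (subst biproduct_decomp[OF b]) (simp_all add: ej)
  finally have "inverse_arrows S1 S2 (q' \<bullet> e \<bullet> j) (q \<bullet> j')"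
    using 1 by (simp add: inverse_arrows_def arrow_iff)
  then show ?thesis using isomorphic_inverse by blast
qed

lemma indecomposable_isomorphic:
  assumes "indecomposable C X" "isomorphic C X Y" shows "indecomposable C Y"
proof -
  have XY: "isomorphic C Y X" "X \<in> Ob C" "Y \<in> Ob C" using assms(2) isomorphic_sym isomorphic_Ob by blast+
  have "direct_sum C X A B" if "direct_sum C Y A B" for A B
    using direct_sum_iso[OF that XY(1)] direct_sum_Ob[OF that] isomorphic_refl by blast
  then show ?thesis
    using assms(1) XY zero_object_isomorphic[of Y X] unfolding indecomposable_def by blast
qed

lemma local_plus:
  assumes "local_endomorphism_ring C X" "\<guillemotleft>f : X \<rightarrow> X\<guillemotright>" "\<guillemotleft>g : X \<rightarrow> X\<guillemotright>" "is_iso C X X (f \<boxplus> g)"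
  shows "is_iso C X X f \<or> is_iso C X X g"
proof -
  have "f \<oplus>\<^bsub>Hom C X X\<^esub> g = f \<boxplus> g" using assms(2) by (simp add: arrow_iff plus_eq)
  then show ?thesis using assms unfolding local_endomorphism_ring_def arrow_def by metis
qed

text \<open>If \<open>X = A \<oplus> B\<close>, then the identity is the sum of the projectors onto \<open>A\<close> and \<open>B\<close>, and so one
  of them is invertible.  A projector is invertible only if the other summand vanishes.\<close>

lemma local_indecomposable:
  assumes X: "local_endomorphism_ring C X" shows "indecomposable C X"
proof -
  have [simp]: "X \<in> Ob C" and nz: "\<not> zero_object C X" using X by (auto simp: local_endomorphism_ring_def)
  have zero_if: "zero_object C B" if b: "is_biproduct C X A B i j p q" and iso: "is_iso C X X (i \<bullet> p)" for A B i j p q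
  proof -
    note [simp] = biproductD[OF b]
    obtain u where u: "inverse_arrows X X (i \<bullet> p) u" using iso is_iso_inverse by blast
    have [simp]: "arr u" "dom u = X" "cod u = X" using inverse_arrowsD[OF u] by blast+
    have "q = q \<bullet> (i \<bullet> p) \<bullet> u" using inverse_arrowsD(10)[OF u] by simp
    also have "\<dots> = nul X B" by simp
    finally have "q = nul X B" .
    then have "q \<bullet> j = nul B B" by (metis biproductD(3,7,8,9)[OF b] comp_nul(1))
    then show ?thesis by (simp add: zero_object_iff)
  qed
  have "zero_object C A \<or> zero_object C B" if ab: "direct_sum C X A B" for A B
  proof -
    obtain i j p q where b: "is_biproduct C X A B i j p q" using ab unfolding direct_sum_def by blast
    note [simp] = biproductD[OF b]
    have "is_iso C X X (i \<bullet> p \<boxplus> j \<bullet> q)" using b is_iso_idm[of X] by (simp add: biproduct_iff)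
    then have "is_iso C X X (i \<bullet> p) \<or> is_iso C X X (j \<bullet> q)"
      using local_plus[OF X] by (simp add: arrow_iff)
    then show ?thesis using zero_if[OF b] zero_if[OF biproduct_swap[OF b]] by blast
  qed
  then show ?thesis using nz by (simp add: indecomposable_def)
qed

end

locale krull_schmidt_category = additive_category K C
  for K :: "('k, 'r) ring_scheme" and C :: "('k, 'o, 'm, 'z) lincat_scheme" +
  assumes idempotents_split: "idempotent_complete C"
    and decomposable: "krull_schmidt C"
begin

text \<open>The complement is the image of the idempotent \<open>1 - i r\<close>.\<close>

lemma retract_complement:
  assumes "\<guillemotleft>i : X \<rightarrow> S\<guillemotright>" "\<guillemotleft>r : S \<rightarrow> X\<guillemotright>" "r \<bullet> i = idm X"
  shows "\<exists>Y j q. is_biproduct C S X Y i j r q"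
proof -
  note [simp] = assms(1,2)[unfolded arrow_iff] assms(3)
  have [simp]: "r \<bullet> i \<bullet> h = h" if "arr h" "cod h = X" for h
    using that comp_reduce[OF assms(3), of h] by simp
  define e where "e = idm S \<boxplus> (\<boxminus> (i \<bullet> r))"
  have [simp]: "arr e" "dom e = S" "cod e = S" by (simp_all add: e_def)
  have re: "r \<bullet> e = nul S X" and ei: "e \<bullet> i = nul X S" by (simp_all add: e_def)
  have "e \<bullet> e = e" by (subst (2) e_def) (simp add: ei comp_reduce[OF ei])
  then obtain Y q j where q: "Y \<in> Ob C" "q \<in> mor C S Y" "j \<in> mor C Y S" and jq: "j \<bullet> q = e" and qj: "q \<bullet> j = idm Y"
    using idempotents_split unfolding idempotent_complete_def by (metis mor_iff \<open>arr e\<close> \<open>dom e = S\<close> \<open>cod e = S\<close> dom_Ob)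
  have [simp]: "arr q" "dom q = S" "cod q = Y" "arr j" "dom j = Y" "cod j = S" "Y \<in> Ob C"
    using q by (simp_all add: mor_iff)
  have "r \<bullet> j = (r \<bullet> e) \<bullet> j" "q \<bullet> i = q \<bullet> (e \<bullet> i)"
    using qj comp_reduce[OF qj, of "q \<bullet> i"] by (simp_all flip: jq)
  then have "r \<bullet> j = nul Y X" "q \<bullet> i = nul X Y" by (simp_all only: re ei) simp_all
  moreover have "i \<bullet> r \<boxplus> j \<bullet> q = idm S"
  proof -
    have "i \<bullet> r \<boxplus> e = e \<boxplus> i \<bullet> r" by (rule plus_commute) simp_all
    also have "\<dots> = idm S" by (simp add: e_def plus_assoc)
    finally show ?thesis by (simp add: jq)
  qed
  ultimately have "is_biproduct C S X Y i j r q" using qj by (simp add: biproduct_iff arrow_iff)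
  then show ?thesis by blast
qed

lemma retract_of_indecomposable:
  assumes "\<guillemotleft>i : X \<rightarrow> Y\<guillemotright>" "\<guillemotleft>r : Y \<rightarrow> X\<guillemotright>" "r \<bullet> i = idm X" "\<not> zero_object C X" "indecomposable C Y"
  shows "is_iso C X Y i"
proof -
  obtain Z j q where b: "is_biproduct C Y X Z i j r q" using retract_complement[OF assms(1-3)] by blast
  then have "zero_object C Z" using assms(4,5) unfolding indecomposable_def direct_sum_def by blast
  then show ?thesis using direct_sum_zero_right[OF b] is_iso_inverse by blast
qed

text \<open>The identity of \<open>X\<close> is a sum of endomorphisms, one through each of the given summands of \<open>S\<close>; as
  \<open>X\<close> is local, one of them is invertible, which makes \<open>X\<close> isomorphic to that summand.  The
  complements are then isomorphic by \<open>biproduct_cancel\<close>.  The induction separates the first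
  summand from the sum of the others.\<close>

lemma exchange:
  assumes "direct_sum_list C S Ys" "\<And>Y. Y \<in> set Ys \<Longrightarrow> local_endomorphism_ring C Y"
    and "is_biproduct C S X S' i j p q" "local_endomorphism_ring C X"
  shows "\<exists>L Y R. Ys = L @ Y # R \<and> isomorphic C X Y \<and> direct_sum_list C S' (L @ R)"
  using assms
proof (induction Ys arbitrary: S S' i j p q)
  case Nil
  then have "direct_sum C S X S'" "zero_object C S" unfolding direct_sum_def by auto
  then show ?case using zero_object_summand Nil.prems(4) unfolding local_endomorphism_ring_def by blast
next
  case (Cons Y Ys)
  then obtain S'' where S'': "direct_sum C S Y S''" "direct_sum_list C S'' Ys" by auto
  then obtain i' j' p' q' where b': "is_biproduct C S Y S'' i' j' p' q'" unfolding direct_sum_def by blast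
  note b = Cons.prems(3)
  note [simp] = biproductD[OF b] biproductD[OF b']
  have nz: "\<not> zero_object C X" using Cons.prems(4) by (simp add: local_endomorphism_ring_def)
  have "p \<bullet> (i' \<bullet> p' \<bullet> i \<boxplus> j' \<bullet> q' \<bullet> i) = idm X" by (subst biproduct_decomp[OF b']) simp_all
  then have "is_iso C X X (p \<bullet> i' \<bullet> p' \<bullet> i \<boxplus> p \<bullet> j' \<bullet> q' \<bullet> i)" using is_iso_idm[of X] by simp
  then have "is_iso C X X (p \<bullet> i' \<bullet> p' \<bullet> i) \<or> is_iso C X X (p \<bullet> j' \<bullet> q' \<bullet> i)"
    using local_plus[OF Cons.prems(4)] by (simp add: arrow_iff)
  then show ?case
  proof
    \<comment> \<open>The component through \<open>Y\<close> is invertible: \<open>X\<close> is isomorphic to \<open>Y\<close>, with \<open>S'\<close> isomorphic to \<open>S''\<close>.\<close>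
    assume "is_iso C X X (p \<bullet> i' \<bullet> p' \<bullet> i)"
    then obtain u where u: "inverse_arrows X X (p \<bullet> i' \<bullet> p' \<bullet> i) u" using is_iso_inverse by blast
    have [simp]: "arr u" "dom u = X" "cod u = X" using inverse_arrowsD[OF u] by blast+
    have "(u \<bullet> p \<bullet> i') \<bullet> p' \<bullet> i = idm X" using inverse_arrowsD(9)[OF u] by simp
    then have iso: "is_iso C X Y (p' \<bullet> i)"
      using retract_of_indecomposable[of "p' \<bullet> i" X Y "u \<bullet> p \<bullet> i'"] nz Cons.prems(2)[of Y] local_indecomposable
      by (simp add: arrow_iff)
    then have "isomorphic C S'' S'" using biproduct_cancel[OF b b'] isomorphic_sym by blast
    then have "direct_sum_list C S' Ys" using S''(2) direct_sum_list_isomorphic by blast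
    then show ?thesis using iso unfolding isomorphic_def by (intro exI[of _ "[]"]) auto
  next
    \<comment> \<open>The component through \<open>S''\<close> is invertible: \<open>X\<close> is a summand of \<open>S''\<close> with complement \<open>Z\<close>, and
    the complement of \<open>X\<close> in \<open>S\<close> can be taken to be \<open>Y \<oplus> Z\<close>.\<close>
    assume "is_iso C X X (p \<bullet> j' \<bullet> q' \<bullet> i)"
    then obtain u where u: "inverse_arrows X X (p \<bullet> j' \<bullet> q' \<bullet> i) u" using is_iso_inverse by blast
    have [simp]: "arr u" "dom u = X" "cod u = X" using inverse_arrowsD[OF u] by blast+
    have r: "(u \<bullet> p \<bullet> j') \<bullet> q' \<bullet> i = idm X" using inverse_arrowsD(9)[OF u] by simp
    then obtain Z jz qz where bz: "is_biproduct C S'' X Z (q' \<bullet> i) jz (u \<bullet> p \<bullet> j') qz"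
      using retract_complement[of "q' \<bullet> i" X S'' "u \<bullet> p \<bullet> j'"] by (auto simp: arrow_iff)
    obtain L Y' R where IH: "Ys = L @ Y' # R" "isomorphic C X Y'" "direct_sum_list C Z (L @ R)"
      using Cons.IH[OF S''(2) _ bz Cons.prems(4)] Cons.prems(2) by auto
    obtain W k l where W: "direct_sum C W Y Z" and bw: "is_biproduct C S X W (j' \<bullet> q' \<bullet> i) k ((u \<bullet> p \<bullet> j') \<bullet> q') l"
      using biproduct_rotate[OF b' bz] by blast
    have "((u \<bullet> p \<bullet> j') \<bullet> q') \<bullet> i = idm X" using r by simp
    then have "isomorphic C W S'"
      using biproduct_cancel[OF b bw] is_iso_idm[of X] isomorphic_sym by simp
    moreover have "direct_sum_list C W (Y # L @ R)" using W IH(3) by auto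
    ultimately have "direct_sum_list C S' ((Y # L) @ R)"
      using direct_sum_list_isomorphic[of W "Y # L @ R" S'] by simp
    then show ?thesis using IH by (intro exI[of _ "Y # L"]) auto
  qed
qed

lemma krull_schmidt_unique:
  assumes "direct_sum_list C S Xs" "\<And>X. X \<in> set Xs \<Longrightarrow> local_endomorphism_ring C X"
    and "direct_sum_list C S Ys" "\<And>Y. Y \<in> set Ys \<Longrightarrow> local_endomorphism_ring C Y"
  shows "mset (map (iso_rep C) Xs) = mset (map (iso_rep C) Ys)"
  using assms
proof (induction Xs arbitrary: S Ys)
  case Nil
  have "Ys = []"
  proof (cases Ys)
    case (Cons Y Zs)
    then show ?thesis
      using Nil zero_object_summand unfolding local_endomorphism_ring_def by (metis direct_sum_list.simps list.set_intros(1))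
  qed
  then show ?case by simp
next
  case (Cons X Xs)
  then obtain S' where S': "direct_sum C S X S'" "direct_sum_list C S' Xs" by auto
  then obtain i j p q where b: "is_biproduct C S X S' i j p q" unfolding direct_sum_def by blast
  obtain L Y R where Ys: "Ys = L @ Y # R" "isomorphic C X Y" "direct_sum_list C S' (L @ R)"
    using exchange[OF Cons.prems(3,4) b] Cons.prems(2)[of X] by auto
  have "iso_rep C X = iso_rep C Y" using Ys(2) isomorphic_Ob[OF Ys(2)] iso_rep_eq_iff by blast
  moreover have "mset (map (iso_rep C) Xs) = mset (map (iso_rep C) (L @ R))"
    using Cons.IH[OF S'(2) _ Ys(3)] Cons.prems(2,4) Ys(1) by auto
  ultimately show ?case using Ys(1) by simp
qed

text \<open>The class of an object in the split Grothendieck group, that is, the indecomposable summands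
  counted with multiplicity.\<close>

definition K0 :: "'o \<Rightarrow> 'o \<Rightarrow>\<^sub>0 int" where
  "K0 X = (\<Sum>Y\<leftarrow>(SOME Xs. direct_sum_list C X Xs \<and> (\<forall>Y\<in>set Xs. local_endomorphism_ring C Y)).
     frag_of (iso_rep C Y))"

lemma K0_eq:
  assumes "direct_sum_list C X Xs" "\<And>Y. Y \<in> set Xs \<Longrightarrow> local_endomorphism_ring C Y"
  shows "K0 X = (\<Sum>Y\<leftarrow>Xs. frag_of (iso_rep C Y))"
proof -
  define Zs where "Zs = (SOME Xs. direct_sum_list C X Xs \<and> (\<forall>Y\<in>set Xs. local_endomorphism_ring C Y))"
  have "direct_sum_list C X Zs \<and> (\<forall>Y\<in>set Zs. local_endomorphism_ring C Y)"
    unfolding Zs_def by (rule someI[of _ Xs]) (use assms in blast)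
  then have "mset (map (iso_rep C) Zs) = mset (map (iso_rep C) Xs)"
    using krull_schmidt_unique assms by blast
  then have "sum_mset (image_mset frag_of (mset (map (iso_rep C) Zs))) =
      sum_mset (image_mset frag_of (mset (map (iso_rep C) Xs)))" by (rule arg_cong)
  then show ?thesis
    unfolding K0_def Zs_def[symmetric] by (simp flip: sum_mset_sum_list mset_map add: o_def)
qed

lemma obtain_decomposition:
  assumes "X \<in> Ob C"
  obtains Xs where "direct_sum_list C X Xs" "\<And>Y. Y \<in> set Xs \<Longrightarrow> local_endomorphism_ring C Y"
  using decomposable assms unfolding krull_schmidt_def by blast

lemma K0_direct_sum: assumes "direct_sum C S X Y" shows "K0 S = K0 X + K0 Y"
proof -
  obtain Xs where Xs: "direct_sum_list C X Xs" "\<And>Y. Y \<in> set Xs \<Longrightarrow> local_endomorphism_ring C Y"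
    using obtain_decomposition direct_sum_Ob[OF assms] by blast
  obtain Ys where Ys: "direct_sum_list C Y Ys" "\<And>Y. Y \<in> set Ys \<Longrightarrow> local_endomorphism_ring C Y"
    using obtain_decomposition direct_sum_Ob[OF assms] by blast
  have "K0 S = (\<Sum>Y\<leftarrow>Xs @ Ys. frag_of (iso_rep C Y))"
    using direct_sum_list_append[OF assms Xs(1) Ys(1)] Xs(2) Ys(2) by (intro K0_eq) auto
  then show ?thesis using K0_eq[OF Xs] K0_eq[OF Ys] by simp
qed

lemma K0_isomorphic: assumes "isomorphic C X Y" shows "K0 X = K0 Y"
proof -
  obtain Xs where Xs: "direct_sum_list C X Xs" "\<And>Y. Y \<in> set Xs \<Longrightarrow> local_endomorphism_ring C Y"
    using obtain_decomposition isomorphic_Ob[OF assms] by blast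
  then show ?thesis using K0_eq[OF Xs] K0_eq[OF direct_sum_list_isomorphic[OF Xs(1) assms]] by simp
qed

lemma K0_zero: "zero_object C Z \<Longrightarrow> K0 Z = 0"
  using K0_eq[of Z "[]"] by simp

text \<open>An indecomposable object is isomorphic to any nonzero term of a decomposition into objects with local
  endomorphism rings.\<close>

lemma indecomposable_local:
  assumes "indecomposable C X" shows "local_endomorphism_ring C X"
proof -
  obtain Xs where Xs: "direct_sum_list C X Xs" "\<And>Y. Y \<in> set Xs \<Longrightarrow> local_endomorphism_ring C Y"
    using obtain_decomposition assms unfolding indecomposable_def by blast
  show ?thesis
  proof (cases Xs)
    case Nil
    then show ?thesis using Xs(1) assms by (simp add: indecomposable_def)
  next
    case (Cons Y Ys)
    then obtain R where R: "direct_sum C X Y R" using Xs(1) by auto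
    have Y: "local_endomorphism_ring C Y" using Xs(2) Cons by simp
    obtain i j p q where b: "is_biproduct C X Y R i j p q" using R unfolding direct_sum_def by blast
    have "zero_object C R" using R Y assms unfolding indecomposable_def local_endomorphism_ring_def by blast
    then have u: "inverse_arrows Y X i p" by (rule direct_sum_zero_right[OF b])
    note [simp] = inverse_arrowsD[OF u]
    \<comment> \<open>Conjugation by the isomorphism transports locality.\<close>
    have tr: "is_iso C Y Y (p \<bullet> f \<bullet> i) \<longleftrightarrow> is_iso C X X f" if "\<guillemotleft>f : X \<rightarrow> X\<guillemotright>" for f
    proof
      note [simp] = that[unfolded arrow_iff]
      have i: "is_iso C Y X i" "is_iso C X Y p"
        using u unfolding is_iso_inverse inverse_arrows_def by blast+
      show "is_iso C X X f \<Longrightarrow> is_iso C Y Y (p \<bullet> f \<bullet> i)" using i is_iso_comp by blast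
      assume "is_iso C Y Y (p \<bullet> f \<bullet> i)"
      then have "is_iso C X X (i \<bullet> (p \<bullet> f \<bullet> i) \<bullet> p)" using i is_iso_comp by blast
      then show "is_iso C X X f" by simp
    qed
    show ?thesis unfolding local_endomorphism_ring_def
    proof (intro conjI ballI impI; (elim conjE)?)
      fix f g assume f: "f \<in> mor C X X" and g: "g \<in> mor C X X" and n: "\<not> is_iso C X X f" "\<not> is_iso C X X g"
      then have [simp]: "arr f" "dom f = X" "cod f = X" "arr g" "dom g = X" "cod g = X" by (simp_all add: mor_iff)
      have "\<not> is_iso C Y Y (p \<bullet> f \<bullet> i \<boxplus> p \<bullet> g \<bullet> i)"
        using local_plus[OF Y, of "p \<bullet> f \<bullet> i" "p \<bullet> g \<bullet> i"] n tr[of f] tr[of g] by (auto simp: arrow_iff)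
      then show "\<not> is_iso C X X (f \<oplus>\<^bsub>Hom C X X\<^esub> g)"
        using tr[of "f \<boxplus> g"] plus_eq[of f X X g] by (simp add: arrow_iff)
    qed (use assms in \<open>simp_all add: indecomposable_def\<close>)
  qed
qed

lemma K0_indecomposable:
  assumes "indecomposable C X" shows "K0 X = frag_of (iso_rep C X)"
proof -
  obtain Z where "zero_object C Z" using zero_object_exists by blast
  moreover from this have "direct_sum C X X Z"
    using direct_sum_zero(1)[of X Z] assms unfolding indecomposable_def direct_sum_def by blast
  ultimately have "direct_sum_list C X [X]" by auto
  then show ?thesis using K0_eq[of X "[X]"] indecomposable_local[OF assms] by simp
qed

lemma obtain_indecomposables:
  assumes "X \<in> Ob C"
  obtains Xs where "direct_sum_list C X Xs" "\<And>Y. Y \<in> set Xs \<Longrightarrow> indecomposable C Y"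
  using obtain_decomposition[OF assms] local_indecomposable by metis

end


section \<open>Long exact sequences of extensions\<close>

context extriangulated_category
begin

abbreviation ext :: "'o \<Rightarrow> 'o \<Rightarrow> 'e set" where "ext D A \<equiv> carrier (Ext C D A)"

abbreviation ext_zero :: "'o \<Rightarrow> 'o \<Rightarrow> 'e" where "ext_zero D A \<equiv> \<zero>\<^bsub>Ext C D A\<^esub>"

lemma Ext_abelian_group: "\<lbrakk>D \<in> Ob C; A \<in> Ob C\<rbrakk> \<Longrightarrow> abelian_group (Ext C D A)"
  using Ext_module module.axioms(2) by blast

lemma ext_zero_closed [simp]: "\<lbrakk>D \<in> Ob C; A \<in> Ob C\<rbrakk> \<Longrightarrow> ext_zero D A \<in> ext D A"
  using Ext_abelian_group abelian_group.axioms abelian_monoid.zero_closed by metis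

lemma ext_zero_plus [simp]:
  assumes "\<delta> \<in> ext D A" "D \<in> Ob C" "A \<in> Ob C" shows "ext_zero D A \<oplus>\<^bsub>Ext C D A\<^esub> \<delta> = \<delta>"
proof -
  interpret abelian_group "Ext C D A" by (rule Ext_abelian_group) (use assms in simp_all)
  show ?thesis using assms(1) by simp
qed

lemma ExtMap_closed [simp]:
  "\<lbrakk>arr c; arr a; \<delta> \<in> ext (cod c) (dom a); dom c = D; cod a = A\<rbrakk> \<Longrightarrow> ExtMap C c a \<delta> \<in> ext D A"
  using ExtMap_linear[of "cod c" "dom c" "dom a" "cod a" c a] by (auto simp: linear_map_def mor_iff)

lemma ExtMap_ExtMap [simp]:
  "\<lbrakk>arr c; arr a; arr c'; arr a'; cod c' = dom c; cod a = dom a'; \<delta> \<in> ext (cod c) (dom a)\<rbrakk>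
    \<Longrightarrow> ExtMap C c' a' (ExtMap C c a \<delta>) = ExtMap C (c \<bullet> c') (a' \<bullet> a) \<delta>"
  by (rule ExtMap_cmp[symmetric, of "cod c" "dom c" "dom c'" "dom a" "cod a" "cod a'"]) (simp_all add: mor_iff)

lemma ExtMap_idm [simp]: "\<lbrakk>\<delta> \<in> ext D A; D \<in> Ob C; A \<in> Ob C\<rbrakk> \<Longrightarrow> ExtMap C (idm D) (idm A) \<delta> = \<delta>"
  by (rule ExtMap_ident)

lemma linear_map_zero:
  assumes "linear_map K V W f" "abelian_group V" "abelian_group W"
  shows "f \<zero>\<^bsub>V\<^esub> = \<zero>\<^bsub>W\<^esub>"
proof -
  interpret V: abelian_group V by fact
  interpret W: abelian_group W by fact
  have "f (\<zero>\<^bsub>V\<^esub> \<oplus>\<^bsub>V\<^esub> \<zero>\<^bsub>V\<^esub>) = f \<zero>\<^bsub>V\<^esub> \<oplus>\<^bsub>W\<^esub> f \<zero>\<^bsub>V\<^esub>" "f \<zero>\<^bsub>V\<^esub> \<in> carrier W"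
    using assms(1) by (auto simp: linear_map_def simp del: V.l_zero V.r_zero)
  then show ?thesis by (metis V.l_zero V.zero_closed W.add.l_cancel_one')
qed

lemma ExtMap_zero [simp]:
  assumes "arr c" "arr a" "cod c = D" "dom a = A"
  shows "ExtMap C c a (ext_zero D A) = ext_zero (dom c) (cod a)"
  using linear_map_zero[OF ExtMap_linear[of "cod c" "dom c" "dom a" "cod a" c a]] assms
  by (auto simp: mor_iff Ext_abelian_group)

lemma ExtMap_nul [simp]:
  shows "\<lbrakk>arr a; X \<in> Ob C; Y \<in> Ob C; \<delta> \<in> ext Y (dom a)\<rbrakk> \<Longrightarrow> ExtMap C (nul X Y) a \<delta> = ext_zero X (cod a)"
    and "\<lbrakk>arr c; X \<in> Ob C; Y \<in> Ob C; \<delta> \<in> ext (cod c) X\<rbrakk> \<Longrightarrow> ExtMap C c (nul X Y) \<delta> = ext_zero (dom c) Y"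
  using linear_map_zero[OF ExtMap_linear_left[of Y X "dom a" "cod a" a \<delta>]]
    linear_map_zero[OF ExtMap_linear_right[of "cod c" "dom c" X Y c \<delta>]]
  by (simp_all add: mor_iff Ext_abelian_group Hom_abelian_group)

lemma ExtMap_plus:
  assumes "arr c" "arr a" "arr a'" "dom a' = dom a" "cod a' = cod a" "\<delta> \<in> ext (cod c) (dom a)"
  shows "ExtMap C c (a \<boxplus> a') \<delta> = ExtMap C c a \<delta> \<oplus>\<^bsub>Ext C (dom c) (cod a)\<^esub> ExtMap C c a' \<delta>"
  using ExtMap_linear_right[of "cod c" "dom c" "dom a" "cod a" c \<delta>] assms
  by (simp add: linear_map_def mor_iff plus_eq)

lemma realisesD:
  assumes "realises C A B D x y \<delta>"
  shows "A \<in> Ob C" "B \<in> Ob C" "D \<in> Ob C" "arr x" "dom x = A" "cod x = B" "arr y" "dom y = B" "cod y = D"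
    "\<delta> \<in> ext D A"
  using assms by (auto simp: realises_def is_sequence_def mor_iff)

lemma conflation_Ob: "conflation C A B D x y \<Longrightarrow> A \<in> Ob C \<and> B \<in> Ob C \<and> D \<in> Ob C"
  unfolding conflation_def using realisesD by blast

lemma realises_biproduct:
  assumes "is_biproduct C S A D i j p q" shows "realises C A S D i q (ext_zero D A)"
  using Rlz_zero[OF assms] biproductD[OF assms] by (simp add: realises_def is_sequence_def mor_iff)

lemma realises_identity:
  assumes "X \<in> Ob C" "zero_object C Z"
  shows "realises C Z X X (nul Z X) (idm X) (ext_zero X Z)"
    "realises C X X Z (idm X) (nul X Z) (ext_zero Z X)"
  using realises_biproduct direct_sum_zero[OF assms] by blast+

lemma realisation_exists:
  assumes "\<delta> \<in> ext D A" "D \<in> Ob C" "A \<in> Ob C"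
  obtains B x y where "realises C A B D x y \<delta>"
proof -
  obtain B x y where s: "is_sequence C A B D x y" and R: "Rlz C D A \<delta> = {s. equivalent_sequences C A D (x, y) s}"
    using Rlz_class[OF assms(2,3,1)] by blast
  have "equivalent_sequences C A D (x, y) (x, y)"
    using s is_iso_idm[of B] unfolding equivalent_sequences_def
    by (intro exI[of _ B] exI[of _ "idm B"]) (auto simp: is_sequence_def mor_iff)
  then show thesis using that[of B x y] s R assms(1) by (simp add: realises_def)
qed

text \<open>The realisation of an extension is a single equivalence class of sequences, and for the zero
  extension it contains the biproduct sequences.\<close>

lemma realises_zero_splits:
  assumes xy: "realises C A B D x y (ext_zero D A)"
  shows "\<exists>s p. is_biproduct C B A D x s p y"
proof -
  note [simp] = realisesD[OF xy]
  obtain S i j p q where b: "is_biproduct C S A D i j p q"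
    using biproduct_exists[of A D] unfolding direct_sum_def by auto
  note [simp] = biproductD[OF b]
  obtain x0 y0 where R: "Rlz C D A (ext_zero D A) = {s. equivalent_sequences C A D (x0, y0) s}"
    using Rlz_class[of D A "ext_zero D A"] by auto
  have "equivalent_sequences C A D (x0, y0) (x, y)" "equivalent_sequences C A D (x0, y0) (i, q)"
    using xy Rlz_zero[OF b] unfolding realises_def R by simp_all
  then obtain B0 B1 b1 B0' B2 b2 where
    1: "is_sequence C A B0 D x0 y0" "is_sequence C A B1 D x y" "is_iso C B0 B1 b1" "b1 \<bullet> x0 = x" "y \<bullet> b1 = y0" and
    2: "is_sequence C A B0' D x0 y0" "is_sequence C A B2 D i q" "is_iso C B0' B2 b2" "b2 \<bullet> x0 = i" "q \<bullet> b2 = y0"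
    unfolding equivalent_sequences_def by auto
  have "B1 = B" "B2 = S" "B0' = B0"
    using 1(1,2) 2(1,2) by (auto simp: is_sequence_def mor_iff)
  then obtain c1 c2 where c1: "inverse_arrows B0 B b1 c1" and c2: "inverse_arrows B0 S b2 c2"
    using 1(3) 2(3) is_iso_inverse by blast
  note [simp] = inverse_arrowsD[OF c1] inverse_arrowsD[OF c2]
  have [simp]: "arr x0" "dom x0 = A" "cod x0 = B0" "arr y0" "dom y0 = B0" "cod y0 = D"
    using 1(1) by (auto simp: is_sequence_def mor_iff)
  have s: "inverse_arrows S B (b1 \<bullet> c2) (b2 \<bullet> c1)" by (simp add: inverse_arrows_def arrow_iff)
  have one: "inverse_arrows A A (idm A) (idm A)" "inverse_arrows D D (idm D) (idm D)"
    by (simp_all add: inverse_arrows_def arrow_iff)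
  have "(b1 \<bullet> c2) \<bullet> i \<bullet> idm A = x" unfolding 2(4)[symmetric] using 1(4) by simp
  moreover have "idm D \<bullet> q \<bullet> (b2 \<bullet> c1) = y"
  proof -
    have "q \<bullet> b2 \<bullet> c1 = y \<bullet> b1 \<bullet> c1" using comp_reduce[OF 2(5), of c1] comp_reduce[OF 1(5), of c1] by simp
    then show ?thesis by simp
  qed
  ultimately show ?thesis using biproduct_iso[OF b s one] by metis
qed

text \<open>This lemma and the next are exactness of the long sequences at \<open>Hom(A, Z)\<close> and
  \<open>Hom(Z, D)\<close>.  If the pushforward along \<open>a\<close> is the split extension, then the conflation maps to
  the realisation \<open>Z \<rightarrow> Z \<oplus> D \<rightarrow> D\<close>, and the component \<open>B \<rightarrow> Z\<close> of this map extends \<open>a\<close>.\<close>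

lemma extend_along_inflation:
  assumes xy: "realises C A B D x y \<delta>" and a: "\<guillemotleft>a : A \<rightarrow> Z\<guillemotright>" and zero: "ExtMap C (idm D) a \<delta> = ext_zero D Z"
  shows "\<exists>b. \<guillemotleft>b : B \<rightarrow> Z\<guillemotright> \<and> b \<bullet> x = a"
proof -
  note [simp] = realisesD[OF xy] a[unfolded arrow_iff]
  obtain S i j p q where b: "is_biproduct C S Z D i j p q"
    using biproduct_exists[of Z D] unfolding direct_sum_def by auto
  note [simp] = biproductD[OF b]
  obtain b where "b \<in> mor C B S" "b \<bullet> x = i \<bullet> a"
    using Rlz_morphism[OF xy realises_biproduct[OF b], of a "idm D"] zero by (auto simp: mor_iff)
  then show ?thesis by (intro exI[of _ "p \<bullet> b"]) (simp add: arrow_iff mor_iff)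
qed

lemma lift_along_deflation:
  assumes xy: "realises C A B D x y \<delta>" and c: "\<guillemotleft>c : Z \<rightarrow> D\<guillemotright>" and zero: "ExtMap C c (idm A) \<delta> = ext_zero Z A"
  shows "\<exists>b. \<guillemotleft>b : Z \<rightarrow> B\<guillemotright> \<and> y \<bullet> b = c"
proof -
  note [simp] = realisesD[OF xy] c[unfolded arrow_iff]
  obtain S i j p q where b: "is_biproduct C S A Z i j p q"
    using biproduct_exists[of A Z] unfolding direct_sum_def by auto
  note [simp] = biproductD[OF b]
  obtain b where b': "b \<in> mor C S B" "y \<bullet> b = c \<bullet> q"
    using Rlz_morphism[OF realises_biproduct[OF b] xy, of "idm A" c] zero by (auto simp: mor_iff)
  have "y \<bullet> b \<bullet> j = c" using comp_reduce[OF b'(2), of j] b'(1) by (simp add: mor_iff)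
  then show ?thesis using b'(1) by (intro exI[of _ "b \<bullet> j"]) (simp add: arrow_iff mor_iff)
qed

text \<open>Two consecutive maps of the long exact sequences compose to zero; the argument compares the conflation
  with \<open>0 \<rightarrow> B \<rightarrow> B\<close>, and for the dual statement with \<open>B \<rightarrow> B \<rightarrow> 0\<close>.\<close>

lemma pullback_along_deflation:
  assumes xy: "realises C A B D x y \<delta>" shows "ExtMap C y (idm A) \<delta> = ext_zero B A"
proof -
  note [simp] = realisesD[OF xy]
  obtain Z where Z: "zero_object C Z" using zero_object_exists by blast
  then have [simp]: "Z \<in> Ob C" by (simp add: zero_object_iff)
  obtain c where "c \<in> mor C B D" "ext_zero B A = ExtMap C c (idm A) \<delta>" "c \<bullet> idm B = y \<bullet> idm B"
    using ET3[OF realises_identity(1)[OF _ Z] xy, of B "nul Z A" "idm B"] by (auto simp: mor_iff)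
  then show ?thesis by (simp add: mor_iff)
qed

lemma pushforward_along_inflation:
  assumes xy: "realises C A B D x y \<delta>" shows "ExtMap C (idm D) x \<delta> = ext_zero D B"
proof -
  note [simp] = realisesD[OF xy]
  obtain Z where Z: "zero_object C Z" using zero_object_exists by blast
  then have [simp]: "Z \<in> Ob C" by (simp add: zero_object_iff)
  have "\<exists>a\<in>mor C A B. ExtMap C (idm D) a \<delta> = ExtMap C (nul D Z) (idm B) (ext_zero Z B) \<and> idm B \<bullet> x = idm B \<bullet> a"
    by (rule ET3_op[OF xy realises_identity(2)[OF _ Z]]) (simp_all add: mor_iff)
  then obtain a where "a \<in> mor C A B" "ExtMap C (idm D) a \<delta> = ExtMap C (nul D Z) (idm B) (ext_zero Z B)"
    "idm B \<bullet> x = idm B \<bullet> a" by blast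
  then show ?thesis by (simp add: mor_iff)
qed

text \<open>Exactness of \<open>Hom(T, D) \<rightarrow> Ext(T, A) \<rightarrow> Ext(T, B)\<close>, and then of
  \<open>Hom(A, T) \<rightarrow> Ext(D, T) \<rightarrow> Ext(B, T)\<close>.  If \<open>\<epsilon>\<close> vanishes in the third term of the
  first sequence, then \<open>x\<close> extends to the middle term of a conflation realising \<open>\<epsilon>\<close>.  Together
  with the identity of \<open>A\<close> this map completes to a morphism of conflations, whose third component is \<open>c\<close>.\<close>

lemma exact_at_Ext_left:
  assumes xy: "realises C A B D x y \<delta>" and e: "\<epsilon> \<in> ext T A" and [simp]: "T \<in> Ob C"
    and zero: "ExtMap C (idm T) x \<epsilon> = ext_zero T B"
  shows "\<exists>c. \<guillemotleft>c : T \<rightarrow> D\<guillemotright> \<and> \<epsilon> = ExtMap C c (idm A) \<delta>"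
proof -
  note [simp] = realisesD[OF xy]
  obtain E u v where uv: "realises C A E T u v \<epsilon>"
    using realisation_exists[OF e assms(3) realisesD(1)[OF xy]] by blast
  obtain b where b: "\<guillemotleft>b : E \<rightarrow> B\<guillemotright>" "b \<bullet> u = x"
    using extend_along_inflation[OF uv _ zero] by (auto simp: arrow_iff)
  obtain c where "c \<in> mor C T D" "ExtMap C (idm T) (idm A) \<epsilon> = ExtMap C c (idm A) \<delta>"
    using ET3[OF uv xy, of "idm A" b] b by (auto simp: arrow_iff mor_iff)
  then show ?thesis using e by (auto simp: arrow_def)
qed

lemma exact_at_Ext_right:
  assumes xy: "realises C A B D x y \<delta>" and e: "\<epsilon> \<in> ext D T" and [simp]: "T \<in> Ob C"
    and zero: "ExtMap C y (idm T) \<epsilon> = ext_zero B T"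
  shows "\<exists>a. \<guillemotleft>a : A \<rightarrow> T\<guillemotright> \<and> \<epsilon> = ExtMap C (idm D) a \<delta>"
proof -
  note [simp] = realisesD[OF xy]
  obtain E u v where uv: "realises C T E D u v \<epsilon>"
    using realisation_exists[OF e realisesD(3)[OF xy] assms(3)] by blast
  obtain b where b: "\<guillemotleft>b : B \<rightarrow> E\<guillemotright>" "v \<bullet> b = y"
    using lift_along_deflation[OF uv _ zero] by (auto simp: arrow_iff)
  obtain a where "a \<in> mor C A T" "ExtMap C (idm D) a \<delta> = ExtMap C (idm D) (idm T) \<epsilon>"
    using ET3_op[OF xy uv, of b "idm D"] b by (auto simp: arrow_iff mor_iff)
  then show ?thesis using e by (auto simp: arrow_def)
qed

section \<open>Pullbacks of conflations\<close>

text \<open>Inflations need not be monic, so \<open>x \<bullet> u = x\<close> does not force \<open>u = 1\<close>.  But \<open>n = 1 - u\<close> kills the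
  extension and therefore factors as \<open>m \<bullet> x\<close>, whence \<open>n \<bullet> n = m \<bullet> x \<bullet> n = 0\<close> and \<open>u = 1 - n\<close>
  has inverse \<open>1 + n\<close>.\<close>

lemma extension_endomorphism_iso:
  assumes xy: "realises C A B D x y \<delta>" and u: "\<guillemotleft>u : A \<rightarrow> A\<guillemotright>"
    and "x \<bullet> u = x" "ExtMap C (idm D) u \<delta> = \<delta>"
  shows "is_iso C A A u"
proof -
  note [simp] = realisesD[OF xy] u[unfolded arrow_iff]
  define n where "n = idm A \<boxplus> (\<boxminus> u)"
  have [simp]: "arr n" "dom n = A" "cod n = A" by (simp_all add: n_def)
  have "ExtMap C (idm D) n \<delta> = ExtMap C (idm D) (u \<boxplus> (\<boxminus> u)) \<delta>"
    unfolding n_def using assms(4) by (simp add: ExtMap_plus del: plus_minus)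
  then have "ExtMap C (idm D) n \<delta> = ext_zero D A" by simp
  then obtain m where m: "\<guillemotleft>m : B \<rightarrow> A\<guillemotright>" "m \<bullet> x = n"
    using extend_along_inflation[OF xy, of n A] by (auto simp: arrow_iff)
  note [simp] = m(1)[unfolded arrow_iff]
  have xn: "x \<bullet> n = nul A B" unfolding n_def using assms(3) by simp
  have nn: "n \<bullet> n = nul A A" using comp_reduce[OF m(2), of n] xn by simp
  have un: "u \<boxplus> n = idm A"
  proof -
    have "u \<boxplus> n = n \<boxplus> u" by (rule plus_commute) simp_all
    also have "\<dots> = idm A" by (simp add: n_def plus_assoc)
    finally show ?thesis .
  qed
  have "u \<bullet> n = (u \<boxplus> n) \<bullet> n" "n \<bullet> u = n \<bullet> (u \<boxplus> n)" using nn by simp_all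
  then have "u \<bullet> n = n" "n \<bullet> u = n" by (simp_all add: un)
  moreover have "u \<boxplus> n \<bullet> u = idm A" "u \<boxplus> u \<bullet> n = idm A" using un calculation by simp_all
  ultimately show ?thesis
    by (intro is_isoI[of u A A "idm A \<boxplus> n"]) (simp_all add: arrow_iff)
qed

text \<open>The identities of \<open>B\<close> and \<open>D\<close> complete to maps between \<open>A\<close> and \<open>A'\<close> in both directions, whose composites are
  automorphisms by the previous lemma.\<close>

lemma deflation_kernel_unique:
  assumes xy: "realises C A B D x y \<delta>" and xy': "realises C A' B D x' y \<delta>'"
  shows "isomorphic C A A'"
proof -
  note [simp] = realisesD[OF xy] realisesD[OF xy']
  obtain a where a: "\<guillemotleft>a : A \<rightarrow> A'\<guillemotright>" "ExtMap C (idm D) a \<delta> = \<delta>'" "x' \<bullet> a = x"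
    using ET3_op[OF xy xy', of "idm B" "idm D"] by (auto simp: arrow_iff mor_iff)
  obtain a' where a': "\<guillemotleft>a' : A' \<rightarrow> A\<guillemotright>" "ExtMap C (idm D) a' \<delta>' = \<delta>" "x \<bullet> a' = x'"
    using ET3_op[OF xy' xy, of "idm B" "idm D"] by (auto simp: arrow_iff mor_iff)
  note [simp] = a(1)[unfolded arrow_iff] a'(1)[unfolded arrow_iff]
  have "is_iso C A A (a' \<bullet> a)"
  proof (rule extension_endomorphism_iso[OF xy])
    show "x \<bullet> a' \<bullet> a = x" using comp_reduce[OF a'(3), of a] a(3) by simp
    have "ExtMap C (idm D) a' (ExtMap C (idm D) a \<delta>) = \<delta>" using a(2) a'(2) by simp
    then show "ExtMap C (idm D) (a' \<bullet> a) \<delta> = \<delta>" by simp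
  qed (simp add: arrow_iff)
  moreover have "is_iso C A' A' (a \<bullet> a')"
  proof (rule extension_endomorphism_iso[OF xy'])
    show "x' \<bullet> a \<bullet> a' = x'" using comp_reduce[OF a(3), of a'] a'(3) by simp
    have "ExtMap C (idm D) a (ExtMap C (idm D) a' \<delta>') = \<delta>'" using a(2) a'(2) by simp
    then show "ExtMap C (idm D) (a \<bullet> a') \<delta>' = \<delta>'" by simp
  qed (simp add: arrow_iff)
  ultimately obtain w w' where w: "inverse_arrows A A (a' \<bullet> a) w" and w': "inverse_arrows A' A' (a \<bullet> a') w'"
    using is_iso_inverse by blast
  have [simp]: "arr w" "dom w = A" "cod w = A" "arr w'" "dom w' = A'" "cod w' = A'"
    using inverse_arrowsD[OF w] inverse_arrowsD[OF w'] by blast+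
  have 1: "(w \<bullet> a') \<bullet> a = idm A" "a \<bullet> a' \<bullet> w' = idm A'"
    using inverse_arrowsD(9)[OF w] inverse_arrowsD(10)[OF w'] by simp_all
  \<comment> \<open>The left inverse \<open>w \<bullet> a'\<close> and the right inverse \<open>a' \<bullet> w'\<close> of \<open>a\<close> agree.\<close>
  have "w \<bullet> a' = (w \<bullet> a') \<bullet> (a \<bullet> a' \<bullet> w')" using 1(2) by simp
  also have "\<dots> = ((w \<bullet> a') \<bullet> a) \<bullet> a' \<bullet> w'" by simp
  also have "\<dots> = a' \<bullet> w'" unfolding 1(1) by simp
  finally have "inverse_arrows A A' a (w \<bullet> a')" using 1 by (simp add: inverse_arrows_def arrow_iff)
  then show ?thesis using isomorphic_inverse by blast
qed

text \<open>The map \<open>(y1, y2) : B1 \<oplus> B2 \<rightarrow> D\<close> is the composite of the deflation \<open>1 \<oplus> y2 : B1 \<oplus> B2 \<rightarrow> B1 \<oplus> D\<close>,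
  with kernel \<open>A2\<close>, and of the split deflation \<open>(y1, 1) : B1 \<oplus> D \<rightarrow> D\<close>, with kernel \<open>B1\<close>.
  The dual of the octahedral axiom yields a kernel \<open>M\<close> of the composite and a conflation
  \<open>A2 \<rightarrow> M \<rightarrow> B1\<close>.\<close>

lemma pullback_conflation:
  assumes r1: "realises C A1 B1 D x1 y1 \<delta>1" and r2: "realises C A2 B2 D x2 y2 \<delta>2"
    and b: "is_biproduct C S B1 B2 i j p q"
  shows "\<exists>M m \<epsilon> d e. realises C M S D m (y1 \<bullet> p \<boxplus> y2 \<bullet> q) \<epsilon> \<and> conflation C A2 M B1 d e"
proof -
  note [simp] = realisesD[OF r1] realisesD[OF r2] biproductD[OF b]
  obtain Z where Z: "zero_object C Z" using zero_object_exists by blast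
  then have [simp]: "Z \<in> Ob C" by (simp add: zero_object_iff)
  obtain V iV jV pV qV where V: "is_biproduct C V B1 D iV jV pV qV"
    using biproduct_exists[of B1 D] unfolding direct_sum_def by auto
  note [simp] = biproductD[OF V]
  define f where "f = iV \<bullet> p \<boxplus> jV \<bullet> y2 \<bullet> q"
  define g where "g = y1 \<bullet> pV \<boxplus> qV"
  define k where "k = iV \<boxplus> (\<boxminus> (jV \<bullet> y1))"
  have [simp]: "arr f" "dom f = S" "cod f = V" "arr g" "dom g = V" "cod g = D" "arr k" "dom k = B1" "cod k = V"
    by (simp_all add: f_def g_def k_def)
  have "\<exists>f' \<delta>. realises C A2 S V f' f \<delta>"
    using Rlz_sum[OF realises_identity(1)[OF _ Z] r2 direct_sum_zero(2)[OF _ Z] b V]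
    by (auto simp: f_def plus_eq)
  moreover have "is_biproduct C V B1 D k jV pV g"
  proof (rule biproductI)
    fix h h' assume h: "\<guillemotleft>h : V \<rightarrow> V\<guillemotright>" "\<guillemotleft>h' : V \<rightarrow> V\<guillemotright>" "pV \<bullet> h = pV \<bullet> h'" "g \<bullet> h = g \<bullet> h'"
    note [simp] = h(1,2)[unfolded arrow_iff]
    have "y1 \<bullet> pV \<bullet> h \<boxplus> qV \<bullet> h = y1 \<bullet> pV \<bullet> h \<boxplus> qV \<bullet> h'" using h(3,4) by (simp add: g_def)
    then have "qV \<bullet> h = qV \<bullet> h'" by (rule plus_cancel) simp_all
    then show "h = h'" using h(3) by (intro biproduct_jointly_monic[OF V, of h h']) simp_all
  qed (simp_all add: arrow_iff k_def g_def)
  then have "realises C B1 V D k g (ext_zero D B1)" by (rule realises_biproduct)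
  ultimately obtain M h d e \<epsilon> \<epsilon>' where "realises C M S D h (g \<bullet> f) \<epsilon>" "realises C A2 M B1 d e \<epsilon>'"
    using ET4_op by metis
  moreover have "g \<bullet> f = y1 \<bullet> p \<boxplus> y2 \<bullet> q" by (simp add: f_def g_def)
  ultimately show ?thesis unfolding conflation_def by metis
qed

text \<open>The pullback of \<open>B1 \<rightarrow> D\<close> and \<open>B2 \<rightarrow> D\<close> is an extension of \<open>B1\<close> by \<open>A2\<close> and of \<open>B2\<close> by \<open>A1\<close>.  The
  two constructions, one for each order of the summands, give kernels \<open>M\<close> and \<open>M'\<close> of the same
  deflation, which agree up to isomorphism.\<close>

lemma pullback_conflations:
  assumes "conflation C A1 B1 D x1 y1" "conflation C A2 B2 D x2 y2"
  shows "\<exists>M M' d e d' e'. isomorphic C M M' \<and> conflation C A2 M B1 d e \<and> conflation C A1 M' B2 d' e'"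
proof -
  obtain \<delta>1 \<delta>2 where r: "realises C A1 B1 D x1 y1 \<delta>1" "realises C A2 B2 D x2 y2 \<delta>2"
    using assms unfolding conflation_def by blast
  note [simp] = realisesD[OF r(1)] realisesD[OF r(2)]
  obtain S i j p q where b: "is_biproduct C S B1 B2 i j p q"
    using biproduct_exists[of B1 B2] unfolding direct_sum_def by auto
  note [simp] = biproductD[OF b]
  have "y2 \<bullet> q \<boxplus> y1 \<bullet> p = y1 \<bullet> p \<boxplus> y2 \<bullet> q" by (rule plus_commute) simp_all
  then show ?thesis
    using pullback_conflation[OF r b] pullback_conflation[OF r(2,1) biproduct_swap[OF b]]
      deflation_kernel_unique by metis
qed

end


section \<open>Cluster-tilting subcategories\<close>

context extriangulated_category
begin

lemma vanishing_conflation_splits: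
  assumes "conflation C A B D x y" "ext D A = {ext_zero D A}"
  shows "\<exists>s p. is_biproduct C B A D x s p y"
proof -
  obtain \<delta> where r: "realises C A B D x y \<delta>" using assms(1) unfolding conflation_def by blast
  have "\<delta> = ext_zero D A" using realisesD(10)[OF r] assms(2) by simp
  then show ?thesis using realises_zero_splits r by simp
qed

lemma vanishing_conflation_direct_sum:
  "\<lbrakk>conflation C A B D x y; ext D A = {ext_zero D A}\<rbrakk> \<Longrightarrow> direct_sum C B A D"
  using vanishing_conflation_splits unfolding direct_sum_def by blast

lemma cluster_tilting_Ob: "cluster_tilting C T \<Longrightarrow> T \<subseteq> Ob C"
  unfolding cluster_tilting_def by blast

lemma cluster_tilting_rigid: "\<lbrakk>cluster_tilting C T; X \<in> T; Y \<in> T\<rbrakk> \<Longrightarrow> ext X Y = {ext_zero X Y}"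
  unfolding cluster_tilting_def by blast

lemma cluster_tilting_memI:
  assumes "cluster_tilting C T" "X \<in> Ob C" "\<And>Y \<epsilon>. \<lbrakk>Y \<in> T; \<epsilon> \<in> ext Y X\<rbrakk> \<Longrightarrow> \<epsilon> = ext_zero Y X"
  shows "X \<in> T"
proof -
  have "ext Y X = {ext_zero Y X}" if "Y \<in> T" for Y
    using assms that ext_zero_closed cluster_tilting_Ob[OF assms(1)] by blast
  moreover have "T = {X \<in> Ob C. \<forall>Y \<in> T. ext Y X = {ext_zero Y X}}"
    using assms(1) unfolding cluster_tilting_def by blast
  ultimately show ?thesis using assms(2) by blast
qed

lemma cluster_tilting_memI':
  assumes "cluster_tilting C T" "X \<in> Ob C" "\<And>Y \<epsilon>. \<lbrakk>Y \<in> T; \<epsilon> \<in> ext X Y\<rbrakk> \<Longrightarrow> \<epsilon> = ext_zero X Y"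
  shows "X \<in> T"
proof -
  have "ext X Y = {ext_zero X Y}" if "Y \<in> T" for Y
    using assms that ext_zero_closed cluster_tilting_Ob[OF assms(1)] by blast
  moreover have "T = {X \<in> Ob C. \<forall>Y \<in> T. ext X Y = {ext_zero X Y}}"
    using assms(1) unfolding cluster_tilting_def by blast
  ultimately show ?thesis using assms(2) by blast
qed

lemma projective_in_cluster_tilting: "\<lbrakk>cluster_tilting C T; projective C P\<rbrakk> \<Longrightarrow> P \<in> T"
  using cluster_tilting_memI'[of T P] cluster_tilting_Ob[of T] unfolding projective_def by blast

lemma cluster_tilting_zero:
  assumes T: "cluster_tilting C T" and "zero_object C Z" shows "Z \<in> T"
proof (rule cluster_tilting_memI[OF T])
  show [simp]: "Z \<in> Ob C" using assms(2) zero_object_iff by blast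
  fix Y \<epsilon> assume Y: "Y \<in> T" and e: "\<epsilon> \<in> ext Y Z"
  then have [simp]: "Y \<in> Ob C" using cluster_tilting_Ob[OF T] by blast
  have "ExtMap C (idm Y) (idm Z) \<epsilon> = ExtMap C (idm Y) (nul Z Z) \<epsilon>" using assms(2) zero_object_iff by simp
  then show "\<epsilon> = ext_zero Y Z" using e by simp
qed

lemma cluster_tilting_direct_sum:
  assumes T: "cluster_tilting C T" and "direct_sum C S X Y" shows "S \<in> T \<longleftrightarrow> X \<in> T \<and> Y \<in> T"
proof -
  have summand: "X \<in> T" if s: "direct_sum C S X Y" and "S \<in> T" for X Y
  proof (rule cluster_tilting_memI[OF T])
    obtain i j p q where b: "is_biproduct C S X Y i j p q" using s unfolding direct_sum_def by blast
    note [simp] = biproductD[OF b]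
    show "X \<in> Ob C" by simp
    fix W \<epsilon> assume W: "W \<in> T" and e: "\<epsilon> \<in> ext W X"
    then have [simp]: "W \<in> Ob C" using cluster_tilting_Ob[OF T] by blast
    have "ExtMap C (idm W) i \<epsilon> \<in> ext W S" using e by simp
    then have "ExtMap C (idm W) i \<epsilon> = ext_zero W S" using cluster_tilting_rigid[OF T W \<open>S \<in> T\<close>] by blast
    then have "ExtMap C (idm W) p (ExtMap C (idm W) i \<epsilon>) = ext_zero W X" by simp
    then show "\<epsilon> = ext_zero W X" using e by simp
  qed
  have "S \<in> T" if "X \<in> T" "Y \<in> T"
  proof (rule cluster_tilting_memI[OF T])
    obtain i j p q where b: "is_biproduct C S X Y i j p q" using assms(2) unfolding direct_sum_def by blast
    note [simp] = biproductD[OF b]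
    show "S \<in> Ob C" by simp
    fix W \<epsilon> assume W: "W \<in> T" and e: "\<epsilon> \<in> ext W S"
    then have [simp]: "W \<in> Ob C" using cluster_tilting_Ob[OF T] by blast
    have "ExtMap C (idm W) p \<epsilon> \<in> ext W X" "ExtMap C (idm W) q \<epsilon> \<in> ext W Y" using e by simp_all
    then have "ExtMap C (idm W) p \<epsilon> = ext_zero W X" "ExtMap C (idm W) q \<epsilon> = ext_zero W Y"
      using cluster_tilting_rigid[OF T W] that by blast+
    then have "ExtMap C (idm W) i (ExtMap C (idm W) p \<epsilon>) = ext_zero W S"
      "ExtMap C (idm W) j (ExtMap C (idm W) q \<epsilon>) = ext_zero W S" by simp_all
    then have "ExtMap C (idm W) (i \<bullet> p) \<epsilon> = ext_zero W S" "ExtMap C (idm W) (j \<bullet> q) \<epsilon> = ext_zero W S"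
      using e by simp_all
    then have "ExtMap C (idm W) (i \<bullet> p \<boxplus> j \<bullet> q) \<epsilon> = ext_zero W S" using e by (simp add: ExtMap_plus)
    then show "\<epsilon> = ext_zero W S" using e b by (simp add: biproduct_iff)
  qed
  then show ?thesis using summand[OF assms(2)] summand[OF direct_sum_swap[OF assms(2)]] by blast
qed

lemma cluster_tilting_isomorphic:
  assumes T: "cluster_tilting C T" and "X \<in> T" "isomorphic C X Y" shows "Y \<in> T"
proof -
  obtain Z where Z: "zero_object C Z" using zero_object_exists by blast
  have X: "X \<in> Ob C" using isomorphic_Ob assms(3) by blast
  then have "direct_sum C X X Z" using direct_sum_zero(1)[OF X Z] unfolding direct_sum_def by blast
  then have "direct_sum C Y X Z"
    using direct_sum_iso assms(3) isomorphic_refl direct_sum_Ob by blast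
  then show ?thesis using cluster_tilting_direct_sum[OF T] assms(2) cluster_tilting_zero[OF T Z] by blast
qed

definition presentation :: "'o set \<Rightarrow> 'o \<Rightarrow> 'o \<Rightarrow> 'o \<Rightarrow> bool" where
  "presentation T T1 T0 X \<longleftrightarrow> T1 \<in> T \<and> T0 \<in> T \<and> (\<exists>x y. conflation C T1 T0 X x y)"

text \<open>Take the conflation \<open>A \<rightarrow> T0 \<rightarrow> X\<close> of a right approximation.  An extension of an object of \<open>T\<close> by
  \<open>A\<close> vanishes in \<open>Ext(T, T0)\<close>, hence comes from a map to \<open>X\<close>; this factors through
  \<open>T0\<close>, so the extension is zero.\<close>

lemma presentation_exists:
  assumes T: "cluster_tilting C T" and X: "X \<in> Ob C"
  shows "\<exists>T1 T0. presentation T T1 T0 X"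
proof -
  obtain T0 y where y: "right_approximation C T T0 X y" "deflation C y"
    using T X unfolding cluster_tilting_def by blast
  obtain A B D x \<delta> where xy': "realises C A B D x y \<delta>"
    using y(2) unfolding deflation_def conflation_def by blast
  have "T0 \<in> Ob C" using y(1) cluster_tilting_Ob[OF T] unfolding right_approximation_def by blast
  then have "B = T0" "D = X" using y(1) X realisesD[OF xy'] unfolding right_approximation_def by (auto simp: mor_iff)
  then have xy: "realises C A T0 X x y \<delta>" using xy' by simp
  note [simp] = realisesD[OF xy]
  have T0: "T0 \<in> T" using y(1) unfolding right_approximation_def by blast
  have "A \<in> T"
  proof (rule cluster_tilting_memI[OF T])
    fix W \<epsilon> assume W: "W \<in> T" and e: "\<epsilon> \<in> ext W A"
    then have [simp]: "W \<in> Ob C" using cluster_tilting_Ob[OF T] by blast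
    have "ExtMap C (idm W) x \<epsilon> \<in> ext W T0" using e by simp
    then have "ExtMap C (idm W) x \<epsilon> = ext_zero W T0" using cluster_tilting_rigid[OF T W T0] by blast
    then obtain c where c: "\<guillemotleft>c : W \<rightarrow> X\<guillemotright>" "\<epsilon> = ExtMap C c (idm A) \<delta>"
      using exact_at_Ext_left[OF xy e] by auto
    then obtain h where h: "h \<in> mor C W T0" "y \<bullet> h = c"
      using y(1) W unfolding right_approximation_def arrow_def by blast
    then have "\<epsilon> = ExtMap C h (idm A) (ExtMap C y (idm A) \<delta>)" using c by (simp add: mor_iff)
    then show "\<epsilon> = ext_zero W A" using pullback_along_deflation[OF xy] h(1) by (simp add: mor_iff)
  qed simp
  then show ?thesis using T0 xy unfolding presentation_def conflation_def by blast
qed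

text \<open>The dual argument, for a left approximation.\<close>

lemma copresentation_exists:
  assumes U: "cluster_tilting C U" and X: "X \<in> Ob C"
  shows "\<exists>U0 U1 x y. U0 \<in> U \<and> U1 \<in> U \<and> conflation C X U0 U1 x y"
proof -
  obtain U0 x where x: "left_approximation C U X U0 x" "inflation C x"
    using U X unfolding cluster_tilting_def by blast
  obtain A B D y \<delta> where xy': "realises C A B D x y \<delta>"
    using x(2) unfolding inflation_def conflation_def by blast
  have "U0 \<in> Ob C" using x(1) cluster_tilting_Ob[OF U] unfolding left_approximation_def by blast
  then have "A = X" "B = U0" using x(1) X realisesD[OF xy'] unfolding left_approximation_def by (auto simp: mor_iff)
  then have xy: "realises C X U0 D x y \<delta>" using xy' by simp
  note [simp] = realisesD[OF xy]
  have U0: "U0 \<in> U" using x(1) unfolding left_approximation_def by blast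
  have "D \<in> U"
  proof (rule cluster_tilting_memI'[OF U])
    fix W \<epsilon> assume W: "W \<in> U" and e: "\<epsilon> \<in> ext D W"
    then have [simp]: "W \<in> Ob C" using cluster_tilting_Ob[OF U] by blast
    have "ExtMap C y (idm W) \<epsilon> \<in> ext U0 W" using e by simp
    then have "ExtMap C y (idm W) \<epsilon> = ext_zero U0 W" using cluster_tilting_rigid[OF U U0 W] by blast
    then obtain a where a: "\<guillemotleft>a : X \<rightarrow> W\<guillemotright>" "\<epsilon> = ExtMap C (idm D) a \<delta>"
      using exact_at_Ext_right[OF xy e] by auto
    then obtain h where h: "h \<in> mor C U0 W" "h \<bullet> x = a"
      using x(1) W unfolding left_approximation_def arrow_def by blast
    then have "\<epsilon> = ExtMap C (idm D) h (ExtMap C (idm D) x \<delta>)" using a by (simp add: mor_iff)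
    then show "\<epsilon> = ext_zero D W" using pushforward_along_inflation[OF xy] h(1) by (simp add: mor_iff)
  qed simp
  then show ?thesis using U0 xy unfolding conflation_def by blast
qed

end

section \<open>The index\<close>

locale krull_schmidt_extriangulated = extriangulated_category K C + krull_schmidt_category K C
  for K :: "('k, 'r) ring_scheme" and C :: "('k, 'o, 'm, 'e) extri"
begin

text \<open>Schanuel's lemma: the pullback of the two presentations is an extension of \<open>T0\<close> by \<open>T1'\<close> and of
  \<open>T0'\<close> by \<open>T1\<close>, and both split because \<open>T\<close> is rigid.\<close>

lemma presentation_unique:
  assumes T: "cluster_tilting C T" and p: "presentation T T1 T0 X" and p': "presentation T T1' T0' X"
  shows "K0 T0 - K0 T1 = K0 T0' - K0 T1'"
proof -
  have mem: "T1 \<in> T" "T0 \<in> T" "T1' \<in> T" "T0' \<in> T" using p p' unfolding presentation_def by blast+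
  obtain M M' d e d' e' where M: "isomorphic C M M'" "conflation C T1' M T0 d e" "conflation C T1 M' T0' d' e'"
    using p p' pullback_conflations unfolding presentation_def by metis
  have "K0 M = K0 T1' + K0 T0" "K0 M' = K0 T1 + K0 T0'"
    using M(2,3) mem cluster_tilting_rigid[OF T] vanishing_conflation_direct_sum K0_direct_sum by metis+
  then show ?thesis using K0_isomorphic[OF M(1)] by (simp add: algebra_simps)
qed

definition index :: "'o set \<Rightarrow> 'o \<Rightarrow> 'o \<Rightarrow>\<^sub>0 int" where
  "index T X = (SOME v. \<exists>T1 T0. presentation T T1 T0 X \<and> v = K0 T0 - K0 T1)"

lemma index_eq:
  assumes T: "cluster_tilting C T" and p: "presentation T T1 T0 X"
  shows "index T X = K0 T0 - K0 T1"
  unfolding index_def by (rule some_equality) (use p presentation_unique[OF T p] in \<open>blast, metis\<close>)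

lemma index_self:
  assumes T: "cluster_tilting C T" and X: "X \<in> T" shows "index T X = K0 X"
proof -
  obtain Z where Z: "zero_object C Z" using zero_object_exists by blast
  have "conflation C Z X X (nul Z X) (idm X)"
    using realises_identity(1)[OF _ Z] X cluster_tilting_Ob[OF T] unfolding conflation_def by blast
  then have "presentation T Z X X" using X cluster_tilting_zero[OF T Z] unfolding presentation_def by blast
  then show ?thesis using index_eq[OF T] K0_zero[OF Z] by simp
qed

lemma index_direct_sum:
  assumes T: "cluster_tilting C T" and S: "direct_sum C S X Y"
  shows "index T S = index T X + index T Y"
proof -
  obtain T1 T0 where p: "presentation T T1 T0 X" using presentation_exists[OF T] direct_sum_Ob[OF S] by blast
  obtain T1' T0' where p': "presentation T T1' T0' Y" using presentation_exists[OF T] direct_sum_Ob[OF S] by blast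
  obtain x y \<delta> where r: "realises C T1 T0 X x y \<delta>" using p unfolding presentation_def conflation_def by blast
  obtain x' y' \<delta>' where r': "realises C T1' T0' Y x' y' \<delta>'" using p' unfolding presentation_def conflation_def by blast
  note [simp] = realisesD[OF r] realisesD[OF r']
  obtain S1 where S1: "direct_sum C S1 T1 T1'" using biproduct_exists[of T1 T1'] by auto
  obtain S0 where S0: "direct_sum C S0 T0 T0'" using biproduct_exists[of T0 T0'] by auto
  obtain f g where "conflation C S1 S0 S f g"
    using Rlz_sum[OF r r'] S1 S0 S unfolding direct_sum_def conflation_def by blast
  moreover have "S1 \<in> T" "S0 \<in> T"
    using cluster_tilting_direct_sum[OF T S1] cluster_tilting_direct_sum[OF T S0] p p'
    unfolding presentation_def by blast+
  ultimately have "presentation T S1 S0 S" unfolding presentation_def by blast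
  then show ?thesis
    using index_eq[OF T p] index_eq[OF T p'] index_eq[OF T, of S1 S0 S] K0_direct_sum[OF S1] K0_direct_sum[OF S0]
    by (simp add: add_diff_eq diff_add_eq diff_diff_eq ac_simps del: diff_eq_eq eq_diff_eq)
qed

lemma index_isomorphic:
  assumes T: "cluster_tilting C T" and "isomorphic C X Y" shows "index T X = index T Y"
proof -
  obtain Z where Z: "zero_object C Z" using zero_object_exists by blast
  have X: "X \<in> Ob C" using isomorphic_Ob assms(2) by blast
  then have "direct_sum C X X Z" using direct_sum_zero(1)[OF X Z] unfolding direct_sum_def by blast
  then have "direct_sum C Y X Z"
    using direct_sum_iso assms(2) isomorphic_refl direct_sum_Ob by blast
  then have "index T Y = index T X + index T Z" by (rule index_direct_sum[OF T])
  then show ?thesis using index_self[OF T cluster_tilting_zero[OF T Z]] K0_zero[OF Z] by simp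
qed

text \<open>The pullback of the conflation along a presentation \<open>T1 \<rightarrow> T0 \<rightarrow> D\<close> is an extension of \<open>T0\<close> by \<open>A\<close>, so it
  is \<open>A \<oplus> T0\<close>; it is also an extension of \<open>B\<close> by \<open>T1\<close>, which is a presentation of \<open>B\<close>.\<close>

lemma index_conflation:
  assumes T: "cluster_tilting C T" and A: "A \<in> T" and c: "conflation C A B D x y"
  shows "index T B = K0 A + index T D"
proof -
  obtain T1 T0 x' y' where p: "presentation T T1 T0 D" and c': "conflation C T1 T0 D x' y'"
    using presentation_exists[OF T] conflation_Ob[OF c] unfolding presentation_def by blast
  have mem: "T1 \<in> T" "T0 \<in> T" using p unfolding presentation_def by blast+
  obtain M M' d e d' e' where M: "isomorphic C M M'" "conflation C T1 M B d e" "conflation C A M' T0 d' e'"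
    using pullback_conflations[OF c c'] by blast
  have s: "direct_sum C M' A T0"
    using M(3) vanishing_conflation_direct_sum cluster_tilting_rigid[OF T mem(2) A] by blast
  then have "M' \<in> T" using cluster_tilting_direct_sum[OF T] A mem by blast
  then have "M \<in> T" using cluster_tilting_isomorphic[OF T] isomorphic_sym[OF M(1)] by blast
  then have "presentation T T1 M B" using M(2) mem unfolding presentation_def by blast
  then show ?thesis
    using index_eq[OF T p] index_eq[OF T, of T1 M B] K0_direct_sum[OF s] K0_isomorphic[OF M(1)] by simp
qed

lemma indec_member:
  assumes T: "cluster_tilting C T" and a: "a \<in> indec C T"
  shows "a \<in> T \<and> indecomposable C a \<and> iso_rep C a = a"
proof -
  obtain X where X: "X \<in> T" "indecomposable C X" "a = iso_rep C X" using a unfolding indec_def by blast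
  have XO: "X \<in> Ob C" using X(2) by (simp add: indecomposable_def)
  then have iso: "isomorphic C X a" using iso_rep_isomorphic X(3) by simp
  then have "iso_rep C a = iso_rep C X" using iso_rep_eq_iff isomorphic_Ob isomorphic_sym by metis
  then show ?thesis
    using X iso cluster_tilting_isomorphic[OF T] indecomposable_isomorphic by simp
qed

text \<open>By additivity, the index of an object of \<open>U\<close> is determined by its class: it is the linear extension of
  the index from \<open>indec U\<close>.\<close>

lemma K0_keys_and_index:
  assumes T: "cluster_tilting C T" and U: "cluster_tilting C U" and X: "X \<in> U"
  shows "Poly_Mapping.keys (K0 X) \<subseteq> indec C U \<and> frag_extend (index T) (K0 X) = index T X"
proof -
  obtain Xs where Xs: "direct_sum_list C X Xs" "\<And>Y. Y \<in> set Xs \<Longrightarrow> indecomposable C Y"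
    using obtain_indecomposables X cluster_tilting_Ob[OF U] by blast
  then show ?thesis using X
  proof (induction Xs arbitrary: X)
    case Nil
    then have "K0 X = 0" "index T X = 0"
      using K0_zero index_self[OF T cluster_tilting_zero[OF T]] by auto
    then show ?case by simp
  next
    case (Cons Y Ys)
    then obtain R where R: "direct_sum C X Y R" "direct_sum_list C R Ys" by auto
    then have mem: "Y \<in> U" "R \<in> U" using cluster_tilting_direct_sum[OF U] Cons.prems(3) by blast+
    have Y: "indecomposable C Y" "Y \<in> Ob C" using Cons.prems(2)[of Y] by (auto simp: indecomposable_def)
    have iY: "index T (iso_rep C Y) = index T Y" using index_isomorphic[OF T iso_rep_isomorphic[OF Y(2)]] by simp
    have IH: "Poly_Mapping.keys (K0 R) \<subseteq> indec C U" "frag_extend (index T) (K0 R) = index T R"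
      using Cons.IH[OF R(2) _ mem(2)] Cons.prems(2) by auto
    have K: "K0 X = frag_of (iso_rep C Y) + K0 R"
      using K0_direct_sum[OF R(1)] K0_indecomposable[OF Y(1)] by simp
    have "iso_rep C Y \<in> indec C U" using mem(1) Y(1) unfolding indec_def by blast
    then have "Poly_Mapping.keys (K0 X) \<subseteq> indec C U"
      unfolding K using IH(1) by (intro order.trans[OF keys_add]) (auto simp: keys_frag_of)
    moreover have "frag_extend (index T) (K0 X) = index T X"
      unfolding K using IH(2) iY index_direct_sum[OF T R(1)] by (simp add: frag_extend_add)
    ultimately show ?case by blast
  qed
qed

section \<open>Comparison of two cluster-tilting subcategories\<close>

text \<open>The index with respect to \<open>T\<close> hits every class \<open>[A]\<close> with \<open>A\<close> in \<open>T\<close>, by a conflation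
  \<open>A \<rightarrow> U0 \<rightarrow> U1\<close>, and fixes the classes of indecomposables common to \<open>T\<close> and \<open>U\<close>.\<close>

lemma indec_diff_lepoll:
  assumes T: "cluster_tilting C T" and U: "cluster_tilting C U" and P: "P \<subseteq> indec C T \<inter> indec C U"
  shows "indec C T - P \<lesssim> indec C U - P"
proof (rule lepoll_of_relative_spanning)
  show "P \<subseteq> indec C U" using P by blast
  show "index T p = frag_of p" if "p \<in> P" for p
  proof -
    have "p \<in> T" "indecomposable C p" "iso_rep C p = p" using indec_member[OF T] that P by blast+
    then show ?thesis using index_self[OF T] K0_indecomposable by simp
  qed
  fix a assume "a \<in> indec C T"
  then have a: "a \<in> T" "indecomposable C a" "iso_rep C a = a" using indec_member[OF T] by blast+
  obtain U0 U1 x y where U01: "U0 \<in> U" "U1 \<in> U" and c: "conflation C a U0 U1 x y"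
    using copresentation_exists[OF U] a(1) cluster_tilting_Ob[OF T] by blast
  have "frag_extend (index T) (K0 U0 - K0 U1) = index T U0 - index T U1"
    using K0_keys_and_index[OF T U] U01 by (simp add: frag_extend_diff)
  also have "\<dots> = frag_of a"
    using index_conflation[OF T a(1) c] K0_indecomposable[OF a(2)] a(3) by simp
  finally have "frag_extend (index T) (K0 U0 - K0 U1) = frag_of a" .
  moreover have "Poly_Mapping.keys (K0 U0 - K0 U1) \<subseteq> indec C U"
    using K0_keys_and_index[OF T U] U01 keys_diff[of "K0 U0" "K0 U1"] by blast
  ultimately show "\<exists>v. Poly_Mapping.keys v \<subseteq> indec C U \<and> frag_extend (index T) v = frag_of a" by blast
qed

lemma indec_diff_eqpoll:
  assumes "cluster_tilting C T" "cluster_tilting C U" "P \<subseteq> indec C T \<inter> indec C U"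
  shows "indec C T - P \<approx> indec C U - P"
  using indec_diff_lepoll[OF assms] indec_diff_lepoll[OF assms(2,1)] assms(3) by (blast intro: lepoll_antisym)

lemma indec_eqpoll: "\<lbrakk>cluster_tilting C T; cluster_tilting C U\<rbrakk> \<Longrightarrow> indec C T \<approx> indec C U"
  using indec_diff_eqpoll[of T U "{}"] by simp

lemma mutable_not_projective: "mutable C T X \<Longrightarrow> \<not> projective C X"
proof
  assume "mutable C T X" "projective C X"
  then obtain X' B x y where c: "conflation C X' B X x y" "\<not> split_conflation C X' B X x y"
    unfolding mutable_def by blast
  have "ext X X' = {ext_zero X X'}" using \<open>projective C X\<close> conflation_Ob[OF c(1)] unfolding projective_def by blast
  then show False using vanishing_conflation_splits[OF c(1)] c unfolding split_conflation_def by blast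
qed

text \<open>The non-projective indecomposables are the mutable ones, and the projective ones are common to
  all cluster-tilting subcategories.\<close>

lemma mut_eqpoll:
  assumes T: "cluster_tilting C T" and U: "cluster_tilting C U" and w: "weak_cluster_structure C"
  shows "mut C T \<approx> mut C U"
proof -
  define P where "P = {X \<in> indec C T. projective C X}"
  have transfer: "X \<in> indec C V'" if "X \<in> indec C V" "projective C X" "cluster_tilting C V" "cluster_tilting C V'"
    for X V V'
  proof -
    have "indecomposable C X" "iso_rep C X = X" using indec_member that(1,3) by blast+
    then show ?thesis using projective_in_cluster_tilting[OF that(4,2)] unfolding indec_def by force
  qed
  have m: "mut C V = {X \<in> indec C V. \<not> projective C X}" if "cluster_tilting C V" for V
    using w that mutable_not_projective unfolding mut_def weak_cluster_structure_def by blast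
  have "mut C T = indec C T - P" unfolding m[OF T] P_def by blast
  moreover have "mut C U = indec C U - P" unfolding m[OF U] P_def using transfer T U by blast
  moreover have "P \<subseteq> indec C T \<inter> indec C U" unfolding P_def using transfer T U by blast
  ultimately show ?thesis using indec_diff_eqpoll[OF T U] by simp
qed

end

theorem corollary3p30:
  fixes K :: "('k, 'r) ring_scheme"
    and C :: "('k, 'o, 'm, 'e) extri"
    and T U :: "'o set"
  assumes "perfect_field K"
    and "cluster_category K TYPE(('k, 'p, 'n, 'f) extri) C"
    and "krull_schmidt C"
    and "cluster_tilting C T"
    and "cluster_tilting C U"
  shows "indec C T \<approx> indec C U \<and>
    ((\<exists>V. cluster_tilting C V \<and> additively_finite C V) \<longrightarrow>
       (\<forall>W. cluster_tilting C W \<longrightarrow> additively_finite C W)) \<and>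
    (weak_cluster_structure C \<longrightarrow> mut C T \<approx> mut C U)"
proof -
  interpret extriangulated_category K C using assms(2) unfolding cluster_category_def by blast
  interpret krull_schmidt_extriangulated K C
    by unfold_locales (use assms(2,3) in \<open>auto simp: cluster_category_def\<close>)
  show ?thesis
    using indec_eqpoll mut_eqpoll assms(4,5) eqpoll_finite_iff unfolding additively_finite_def by blast
qed

end
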